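(* Let $G$ be a finite, simple, connected, undirected graph that contains no induced subgraph isomorphic to the claw $K_{1,3}$ and no induced subgraph isomorphic to $P_6$. Then for any finite, simple, connected, undirected graph $H$, $\gamma(G\square H)\geq \gamma(G)\gamma(H)$.
   Context: $P_n$ denotes the path on $n$ vertices. The domination number $\gamma(G)$ is the minimum cardinality of a set $S\subseteq V(G)$ such that every vertex of $G$ lies in $S$ or is adjacent to a vertex of $S$. The Cartesian product $G\square H$ has vertex set $V(G)\times V(H)$, with $(u_1,v_1)$ and $(u_2,v_2)$ adjacent if and only if either $v_1=v_2$ and $u_1u_2\in E(G)$, or $u_1=u_2$ and $v_1v_2\in E(H)$. *)

theory Defs
  imports "Graph_Theory.Graph_Theory"
begin

text \<open>
  A finite simple undirected graph is a \<^locale>\<open>pair_graph\<close>: a finite, loop-free, symmetric digraph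
  whose arcs are ordered pairs of vertices, so that there are no parallel arcs and every
  undirected edge appears in both directions.
\<close>

definition path_graph :: "nat \<Rightarrow> nat pair_pre_digraph" where
  "path_graph n = \<lparr> pverts = {..<n},
     parcs = {(i, j). i < n \<and> j < n \<and> (j = Suc i \<or> i = Suc j)} \<rparr>"

definition dominating_set :: "'a pair_pre_digraph \<Rightarrow> 'a set \<Rightarrow> bool" where
  "dominating_set G S \<longleftrightarrow> S \<subseteq> pverts G \<and>
     (\<forall>v \<in> pverts G. v \<in> S \<or> (\<exists>u \<in> S. (v, u) \<in> parcs G))"

text \<open>Meaningful for finite graphs only, since infinite sets have \<^const>\<open>card\<close> 0.\<close>
definition domination_number :: "'a pair_pre_digraph \<Rightarrow> nat" where
  "domination_number G = (LEAST k. \<exists>S. dominating_set G S \<and> card S = k)"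

definition cartesian_product ::
    "'a pair_pre_digraph \<Rightarrow> 'b pair_pre_digraph \<Rightarrow> ('a \<times> 'b) pair_pre_digraph" where
  "cartesian_product G H = \<lparr> pverts = pverts G \<times> pverts H,
     parcs = {((u1, v1), (u2, v2)).
       {u1, u2} \<subseteq> pverts G \<and> {v1, v2} \<subseteq> pverts H \<and>
       (v1 = v2 \<and> (u1, u2) \<in> parcs G \<or> u1 = u2 \<and> (v1, v2) \<in> parcs H)} \<rparr>"

lemma pair_graph_path_graph: "pair_graph (path_graph n)"
proof -
  have "finite (parcs (path_graph n))"
    by (rule finite_subset[of _ "{..<n} \<times> {..<n}"]) (auto simp: path_graph_def)
  then show ?thesis
    by unfold_locales (auto simp: path_graph_def symmetric_def intro!: symI)
qed

lemma pair_graph_cartesian_product: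
  assumes "pair_graph G" "pair_graph H"
  shows "pair_graph (cartesian_product G H)"
proof -
  interpret G: pair_graph G by fact
  interpret H: pair_graph H by fact
  have "finite (pverts G \<times> pverts H)"
    using G.pair_finite_verts H.pair_finite_verts by simp
  moreover have "finite (parcs (cartesian_product G H))"
  proof (rule finite_subset)
    show "parcs (cartesian_product G H) \<subseteq> (pverts G \<times> pverts H) \<times> (pverts G \<times> pverts H)"
      by (auto simp: cartesian_product_def)
    show "finite ((pverts G \<times> pverts H) \<times> (pverts G \<times> pverts H))"
      using G.pair_finite_verts H.pair_finite_verts by simp
  qed
  moreover have "sym (parcs (cartesian_product G H))"
  proof (rule symI)
    fix x y assume "(x, y) \<in> parcs (cartesian_product G H)"
    moreover have "sym (parcs G)" "sym (parcs H)"
      using G.pair_sym_arcs H.pair_sym_arcs by (simp_all add: symmetric_def)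
    ultimately show "(y, x) \<in> parcs (cartesian_product G H)"
      by (cases x; cases y) (auto simp: cartesian_product_def dest: symD)
  qed
  moreover have "fst e \<in> pverts (cartesian_product G H)"
      "snd e \<in> pverts (cartesian_product G H)" "fst e \<noteq> snd e"
      if "e \<in> parcs (cartesian_product G H)" for e
    using that by (auto simp: cartesian_product_def dest: G.pair_no_loops H.pair_no_loops)
  ultimately show ?thesis
    by unfold_locales (simp_all add: symmetric_def cartesian_product_def)
qed

lemma domination_number_attained:
  obtains S where "dominating_set G S" "card S = domination_number G"
proof -
  have "dominating_set G (pverts G)" by (simp add: dominating_set_def)
  then have "\<exists>k S. dominating_set G S \<and> card S = k" by blast
  then have "\<exists>S. dominating_set G S \<and> card S = domination_number G"
    unfolding domination_number_def by (rule LeastI_ex)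
  with that show ?thesis by blast
qed

lemma domination_number_le: "dominating_set G S \<Longrightarrow> domination_number G \<le> card S"
  unfolding domination_number_def by (rule Least_le) blast

end

theory Submission
  imports Defs
begin

text \<open>
  A dominating set of the product is a family \<open>D h\<close> of subsets of \<open>V(G)\<close>, one for each vertex \<open>h\<close> of
  \<open>H\<close>, such that every vertex of \<open>G\<close> not dominated by \<open>D h\<close> inside \<open>G\<close> lies in \<open>D k\<close> for some neighbour
  \<open>k\<close> of \<open>h\<close>. For any cell \<open>S\<close> of vertices of \<open>G\<close>, the vertices \<open>h\<close> such that \<open>D h\<close> meets or dominates
  \<open>S\<close> therefore dominate \<open>H\<close>. It suffices to find \<open>\<gamma>(G)\<close> cells of which every set \<open>X\<close> of vertices
  meets or dominates at most \<open>|X|\<close>.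

  Unless some vertex \<open>v\<close> has the property that \<open>V - N[v]\<close> is covered by two cliques, \<open>G\<close> has no
  induced \<open>C\<^sub>6\<close>, and its minimum connected dominating set can be taken to be a clique or two cliques
  glued at a vertex. The private neighbourhoods of the vertices of this set (other than the gluing
  vertex) are pairwise anticomplete, and they serve as cells, two of them being merged if some
  vertex sees both.

  In the exceptional case \<open>\<gamma>(G) \<le> 3\<close>, but a suitable choice of cells need not exist (the line graph of
  \<open>K\<^sub>6\<close> has no three disjoint such cells), and the assignment of the elements of \<open>D h\<close> to three
  dominating sets of \<open>H\<close> has to depend on the whole family \<open>D\<close>.
\<close>

section \<open>Simple graphs as adjacency relations\<close>

locale simple_graph =
  fixes V :: "'a set" and E :: "'a \<Rightarrow> 'a \<Rightarrow> bool"
  assumes finite_V: "finite V"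
    and adj_sym: "E u v \<Longrightarrow> E v u"
    and adj_irrefl: "\<not> E u u"
    and adj_V: "E u v \<Longrightarrow> u \<in> V"
begin

lemma adj_commute: "E u v \<longleftrightarrow> E v u"
  using adj_sym by blast

lemma adj_V': "E u v \<Longrightarrow> v \<in> V"
  using adj_sym adj_V by blast

definition covers :: "'a set \<Rightarrow> 'a \<Rightarrow> bool" where
  "covers S x \<longleftrightarrow> x \<in> S \<or> (\<exists>d\<in>S. E x d)"

definition dominating :: "'a set \<Rightarrow> bool" where
  "dominating S \<longleftrightarrow> S \<subseteq> V \<and> (\<forall>x\<in>V. covers S x)"

definition clique :: "'a set \<Rightarrow> bool" where
  "clique X \<longleftrightarrow> X \<subseteq> V \<and> (\<forall>x\<in>X. \<forall>y\<in>X. x \<noteq> y \<longrightarrow> E x y)"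

text \<open>Connectivity of the subgraph induced on \<open>X\<close>, phrased by edges leaving
  proper nonempty subsets instead of walks. The empty set and singletons are connected.\<close>

definition conn :: "'a set \<Rightarrow> bool" where
  "conn X \<longleftrightarrow> (\<forall>S\<subseteq>X. S \<noteq> {} \<longrightarrow> S \<noteq> X \<longrightarrow> (\<exists>u\<in>S. \<exists>w\<in>X - S. E u w))"

definition two_clique_cover :: bool where
  "two_clique_cover \<longleftrightarrow> (\<exists>v\<in>V. \<exists>A B. clique A \<and> clique B \<and>
     (\<forall>x\<in>V. x = v \<or> E v x \<or> x \<in> A \<or> x \<in> B))"

definition touches :: "'a \<Rightarrow> 'a set \<Rightarrow> bool" where
  "touches x S \<longleftrightarrow> (\<exists>p\<in>S. x = p \<or> E x p)"

text \<open>The cells \<open>P a\<close> are indexed by a dominating set \<open>C\<close>. When a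
  vertex touches two cells these have to be merged, which loses one cell; the clause with
  \<open>card S < card C\<close> makes up for this loss. By the last clause any two touched pairs
  share an index, so that merging a single pair is enough.\<close>

definition anticomplete_cells :: "'a set \<Rightarrow> ('a \<Rightarrow> 'a set) \<Rightarrow> bool" where
  "anticomplete_cells C P \<longleftrightarrow> dominating C \<and> (\<forall>a\<in>C. P a \<noteq> {} \<and> P a \<subseteq> V) \<and>
     (\<forall>a\<in>C. \<forall>b\<in>C. a \<noteq> b \<longrightarrow> (\<forall>p\<in>P a. \<not> touches p (P b))) \<and>
     (\<forall>x. \<forall>a\<in>C. \<forall>b\<in>C. a \<noteq> b \<longrightarrow> touches x (P a) \<longrightarrow> touches x (P b) \<longrightarrow>
        (\<exists>S. dominating S \<and> card S < card C)) \<and>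
     (\<forall>x y. \<forall>a\<in>C. \<forall>b\<in>C. \<forall>c\<in>C. \<forall>d\<in>C. touches x (P a) \<longrightarrow> touches x (P b) \<longrightarrow>
        touches y (P c) \<longrightarrow> touches y (P d) \<longrightarrow> a \<noteq> b \<longrightarrow> c \<noteq> d \<longrightarrow> {a, b} \<inter> {c, d} \<noteq> {})"

lemma covers_mono: "covers S x \<Longrightarrow> S \<subseteq> T \<Longrightarrow> covers T x"
  unfolding covers_def by blast

lemma clique_adj: "clique X \<Longrightarrow> x \<in> X \<Longrightarrow> y \<in> X \<Longrightarrow> x \<noteq> y \<Longrightarrow> E x y"
  unfolding clique_def by blast

text \<open>A cut of \<open>X\<close> either splits \<open>Y\<close>, or has \<open>Y\<close> on one
  side; in that case the edge from a vertex on the other side into \<open>Y\<close> crosses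
  it.\<close>

lemma conn_hub:
  assumes "conn Y" "Y \<noteq> {}" "Y \<subseteq> X" "\<And>x. x \<in> X \<Longrightarrow> x \<notin> Y \<Longrightarrow> \<exists>y\<in>Y. E x y"
  shows "conn X"
  unfolding conn_def
proof (intro allI impI)
  fix S assume S: "S \<subseteq> X" "S \<noteq> {}" "S \<noteq> X"
  consider "Y \<subseteq> S" | "Y \<inter> S = {}" | "Y \<inter> S \<noteq> {}" "Y \<inter> S \<noteq> Y" by blast
  then show "\<exists>u\<in>S. \<exists>w\<in>X - S. E u w"
  proof cases
    case 1
    obtain x where "x \<in> X" "x \<notin> S" using S by blast
    then show ?thesis using 1 assms(4) adj_sym by (metis DiffI subsetD)
  next
    case 2
    obtain x where "x \<in> S" using S by blast
    then obtain y where "y \<in> Y" "E x y" using 2 S assms(4) by (metis disjoint_iff subsetD)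
    then show ?thesis using 2 \<open>x \<in> S\<close> assms(3) by blast
  next
    case 3
    then obtain u w where "u \<in> Y \<inter> S" "w \<in> Y - Y \<inter> S" "E u w"
      using assms(1) unfolding conn_def by (metis inf_le1)
    then show ?thesis using assms(3) by blast
  qed
qed

lemma conn_singleton: "conn {r}"
  unfolding conn_def by blast

lemma conn_adj:
  assumes "conn X" "x \<in> X" "X \<noteq> {x}"
  shows "\<exists>y\<in>X. E x y"
  using assms unfolding conn_def by (metis DiffD1 empty_iff empty_subsetI insert_subset singletonD)

text \<open>A maximal proper nonempty connected subset misses exactly one vertex: an edge leaving it
  adds one vertex and keeps it connected, so by maximality the result is all of
  \<open>X\<close>.\<close>

lemma conn_noncut_exists:
  assumes "conn X" "finite X" "X \<noteq> {}"
  shows "\<exists>x\<in>X. conn (X - {x})"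
proof -
  obtain r where r: "r \<in> X" using assms(3) by blast
  show ?thesis
  proof (cases "X = {r}")
    case True
    then show ?thesis unfolding conn_def by auto
  next
    case False
    define F where "F = {Y. Y \<subset> X \<and> Y \<noteq> {} \<and> conn Y}"
    have "{r} \<in> F" using r False conn_singleton unfolding F_def by auto
    moreover have "finite F"
      by (rule finite_subset[of _ "Pow X"]) (auto simp: F_def assms(2))
    ultimately obtain Y where Y: "Y \<in> F" "\<And>Z. Z \<in> F \<Longrightarrow> Y \<subseteq> Z \<Longrightarrow> Z = Y"
      using finite_has_maximal2 by (metis (no_types, lifting))
    obtain u x where ux: "u \<in> Y" "x \<in> X - Y" "E u x"
      using Y(1) assms(1) unfolding F_def conn_def by (smt (verit) mem_Collect_eq psubsetE)
    have "conn (insert x Y)"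
      by (rule conn_hub[of Y]) (use Y(1) ux adj_sym in \<open>auto simp: F_def\<close>)
    then have "insert x Y = X"
      using Y(1) Y(2)[of "insert x Y"] ux unfolding F_def by auto
    then have "X - {x} = Y" using ux by blast
    then show ?thesis using Y(1) ux unfolding F_def by auto
  qed
qed

end

locale claw_free_graph = simple_graph +
  assumes claw: "E c x \<Longrightarrow> E c y \<Longrightarrow> E c z \<Longrightarrow> x \<noteq> y \<Longrightarrow> y \<noteq> z \<Longrightarrow> x \<noteq> z \<Longrightarrow>
    E x y \<or> E y z \<or> E x z"
begin

lemma claw_nonadj:
  assumes "E c x" "E c y" "E c z" "\<not> E x y" "\<not> E y z" "\<not> E x z"
  shows "x = y \<or> y = z \<or> x = z"
  using claw assms by blast

end

section \<open>Dominating sets of a product, fibre by fibre\<close>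

text \<open>\<open>D h\<close> is the fibre of the dominating set over \<open>h\<close>; \<open>g\<close> and \<open>m\<close> are lower bounds for the sizes of
  dominating sets of the two factors.\<close>
locale product_domination = simple_graph V E
  for V :: "'a set" and E :: "'a \<Rightarrow> 'a \<Rightarrow> bool" +
  fixes W :: "'b set" and F :: "'b \<Rightarrow> 'b \<Rightarrow> bool" and D :: "'b \<Rightarrow> 'a set"
    and g m :: nat
  assumes finite_W: "finite W"
    and F_sym: "F h k \<Longrightarrow> F k h"
    and F_irrefl: "\<not> F h h"
    and D_V: "h \<in> W \<Longrightarrow> D h \<subseteq> V"
    and D_covers: "h \<in> W \<Longrightarrow> x \<in> V \<Longrightarrow> covers (D h) x \<or> (\<exists>k\<in>W. F h k \<and> x \<in> D k)"
    and g_le: "dominating S \<Longrightarrow> g \<le> card S"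
    and m_le: "T \<subseteq> W \<Longrightarrow> (\<And>h. h \<in> W \<Longrightarrow> h \<in> T \<or> (\<exists>k\<in>T. F h k)) \<Longrightarrow> m \<le> card T"
begin

lemma finite_D: "h \<in> W \<Longrightarrow> finite (D h)"
  using D_V finite_V finite_subset by blast

text \<open>Double counting of the pairs \<open>(i, h)\<close> with \<open>i \<in> c h\<close>: each
  colour occurs on a dominating set of the second factor, hence at least \<open>m\<close>
  times.\<close>

lemma colouring_bound:
  assumes I: "finite I"
    and dom: "\<And>i h. i \<in> I \<Longrightarrow> h \<in> W \<Longrightarrow> i \<in> c h \<or> (\<exists>k\<in>W. F h k \<and> i \<in> c k)"
    and card: "\<And>h. h \<in> W \<Longrightarrow> card {i \<in> I. i \<in> c h} \<le> card (D h)"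
  shows "card I * m \<le> (\<Sum>h\<in>W. card (D h))"
proof -
  have "card I * m = (\<Sum>i\<in>I. m)" by simp
  also have "\<dots> \<le> (\<Sum>i\<in>I. card {h \<in> W. i \<in> c h})"
    by (intro sum_mono m_le) (use dom in auto)
  also have "\<dots> = (\<Sum>i\<in>I. \<Sum>h\<in>W. if i \<in> c h then 1 else 0)"
    using finite_W by (simp add: sum.If_cases Int_def)
  also have "\<dots> = (\<Sum>h\<in>W. \<Sum>i\<in>I. if i \<in> c h then 1 else 0)"
    by (rule sum.swap)
  also have "\<dots> = (\<Sum>h\<in>W. card {i \<in> I. i \<in> c h})"
    using I by (simp add: sum.If_cases Int_def)
  also have "\<dots> \<le> (\<Sum>h\<in>W. card (D h))"
    by (intro sum_mono card)
  finally show ?thesis .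
qed

definition meets_or_covers :: "'a set \<Rightarrow> 'a set \<Rightarrow> bool" where
  "meets_or_covers X S \<longleftrightarrow> X \<inter> S \<noteq> {} \<or> (\<forall>x\<in>S. covers X x)"

text \<open>The colours are the cells. If \<open>D h\<close> neither meets nor covers a cell, an
  uncovered vertex of the cell lies in a neighbouring fibre, which then meets the cell.\<close>

lemma cell_bound:
  assumes I: "finite I" and S: "\<And>i. i \<in> I \<Longrightarrow> S i \<subseteq> V"
    and card: "\<And>X. X \<subseteq> V \<Longrightarrow> card {i \<in> I. meets_or_covers X (S i)} \<le> card X"
  shows "card I * m \<le> (\<Sum>h\<in>W. card (D h))"
proof (rule colouring_bound[where c = "\<lambda>h. {i. meets_or_covers (D h) (S i)}"])
  fix i h assume ih: "i \<in> I" "h \<in> W"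
  show "i \<in> {i. meets_or_covers (D h) (S i)} \<or> (\<exists>k\<in>W. F h k \<and> i \<in> {i. meets_or_covers (D k) (S i)})"
  proof (cases "meets_or_covers (D h) (S i)")
    case False
    then obtain x where "x \<in> S i" "\<not> covers (D h) x"
      unfolding meets_or_covers_def by blast
    moreover have "x \<in> V" using S ih \<open>x \<in> S i\<close> by blast
    ultimately obtain k where "k \<in> W" "F h k" "x \<in> D k" using D_covers ih by blast
    then show ?thesis using \<open>x \<in> S i\<close> unfolding meets_or_covers_def by blast
  qed simp
qed (use I D_V card in auto)

text \<open>The two cells are a maximal clique and its complement.\<close>
lemma bound_if_le_2:
  assumes "g \<le> 2"
  shows "g * m \<le> (\<Sum>h\<in>W. card (D h))"
proof -
  consider "g = 0" | "g = 1" | "g = 2" using assms by linarith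
  then show ?thesis
  proof cases
    case 2
    then have "V \<noteq> {}" using g_le[of "{}"] unfolding dominating_def by auto
    have "card {()} * m \<le> (\<Sum>h\<in>W. card (D h))"
    proof (rule cell_bound[where S = "\<lambda>_. V"])
      fix X assume X: "X \<subseteq> V"
      show "card {i \<in> {()}. meets_or_covers X V} \<le> card X"
      proof (cases "X = {}")
        case True
        then have "{i \<in> {()}. meets_or_covers X V} = {}"
          using \<open>V \<noteq> {}\<close> unfolding meets_or_covers_def covers_def by auto
        then show ?thesis by simp
      next
        case False
        then have "card X \<ge> 1" using X finite_V finite_subset
          by (metis One_nat_def Suc_leI card_gt_0_iff)
        moreover have "card {i \<in> {()}. meets_or_covers X V} \<le> card {()}"
          by (rule card_mono) auto
        ultimately show ?thesis by simp
      qed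
    qed auto
    then show ?thesis using 2 by simp
  next
    case 3
    define Q where "Q = {K. clique K}"
    have "finite Q"
      by (rule finite_subset[of _ "Pow V"]) (auto simp: Q_def clique_def finite_V)
    moreover have "{} \<in> Q" unfolding Q_def clique_def by auto
    ultimately obtain K where K: "clique K" "\<And>L. clique L \<Longrightarrow> K \<subseteq> L \<Longrightarrow> L = K"
      unfolding Q_def using finite_has_maximal2 by (metis (no_types, lifting) mem_Collect_eq)
    have out: "\<exists>y\<in>K. \<not> E x y" if "x \<in> V" "x \<notin> K" for x
    proof (rule ccontr)
      assume "\<not> (\<exists>y\<in>K. \<not> E x y)"
      then have "clique (insert x K)"
        using K(1) that adj_sym unfolding clique_def by (metis insertE insert_subset)
      then show False using K(2) that by blast
    qed
    \<comment> \<open>Since \<open>g = 2\<close>, no single vertex dominates; a vertex of the clique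
      \<open>K\<close> sees the rest of \<open>K\<close>, so it misses some vertex outside.\<close>
    have ins: "\<exists>y\<in>V - K. \<not> E x y" if "x \<in> K" for x
    proof (rule ccontr)
      assume *: "\<not> (\<exists>y\<in>V - K. \<not> E x y)"
      have "dominating {x}"
        using * that K(1) adj_sym unfolding dominating_def covers_def clique_def by blast
      then show False using g_le 3 by fastforce
    qed
    have single: "\<not> meets_or_covers {x} Z" if "y \<in> Z" "\<not> E x y" "x \<notin> Z" for x y Z
    proof -
      have "\<not> covers {x} y" using that adj_commute[of x y] unfolding covers_def by auto
      then show ?thesis using that unfolding meets_or_covers_def by blast
    qed
    define S where "S = (\<lambda>b. if b then K else V - K)"
    have "card (UNIV :: bool set) * m \<le> (\<Sum>h\<in>W. card (D h))"
    proof (rule cell_bound[where S = S])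
      fix X assume X: "X \<subseteq> V"
      have fX: "finite X" using X finite_V finite_subset by blast
      let ?J = "{i \<in> UNIV. meets_or_covers X (S i)}"
      have J2: "card ?J \<le> 2"
        using card_mono[of "UNIV :: bool set" ?J] by simp
      consider "X = {}" | x where "X = {x}" | "card X \<ge> 2"
        by (metis One_nat_def card_1_singletonE card_eq_0_iff fX less_2_cases not_less)
      then show "card ?J \<le> card X"
      proof cases
        case 1
        have "V \<noteq> {}" using g_le[of "{}"] 3 unfolding dominating_def by auto
        then have "K \<noteq> {}" "V - K \<noteq> {}" using out ins by blast+
        then have "?J = {}" using 1 unfolding meets_or_covers_def S_def covers_def by auto
        then show ?thesis by (metis card.empty le0)
      next
        case (2 x)
        have "\<exists>y\<in>S (x \<notin> K). \<not> E x y"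
          using 2 X out[of x] ins[of x] unfolding S_def by (cases "x \<in> K") auto
        then obtain y where "y \<in> S (x \<notin> K)" "\<not> E x y" by blast
        moreover have "x \<notin> S (x \<notin> K)" unfolding S_def by auto
        ultimately have not: "\<not> meets_or_covers X (S (x \<notin> K))"
          using 2 single by simp
        have "i = (x \<in> K)" if "meets_or_covers X (S i)" for i
        proof (rule ccontr)
          assume "i \<noteq> (x \<in> K)"
          then have "i = (x \<notin> K)" by simp
          then show False using that not by (simp only: not_True_eq_False)
        qed
        then have "?J \<subseteq> {x \<in> K}" by (simp add: subset_iff)
        then show ?thesis using 2 card_mono[of "{x \<in> K}" ?J] by simp
      next
        case 3
        then show ?thesis using J2 by linarith
      qed
    qed (use K(1) in \<open>auto simp: S_def clique_def\<close>)
    then show ?thesis using 3 by simp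
  qed simp
qed

end

locale claw_free_product = product_domination V E W F D g m + claw_free_graph V E
  for V :: "'a set" and E :: "'a \<Rightarrow> 'a \<Rightarrow> bool" and W :: "'b set" and F :: "'b \<Rightarrow> 'b \<Rightarrow> bool"
    and D :: "'b \<Rightarrow> 'a set" and g m :: nat
begin

text \<open>If no vertex touches two cells, distinct cells met or dominated by \<open>X\<close> are touched by distinct
  elements of \<open>X\<close>. Otherwise two cells touched by a common vertex are merged: as touched pairs
  intersect pairwise, an element touching another cell can then not help to dominate the merged
  one.\<close>
lemma bound_if_anticomplete_cells:
  assumes "anticomplete_cells C P"
  shows "g * m \<le> (\<Sum>h\<in>W. card (D h))"
proof -
  have domC: "dominating C"
    and ne: "\<And>a. a \<in> C \<Longrightarrow> P a \<noteq> {} \<and> P a \<subseteq> V"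
    and anti: "\<And>a b p. a \<in> C \<Longrightarrow> b \<in> C \<Longrightarrow> a \<noteq> b \<Longrightarrow> p \<in> P a \<Longrightarrow> \<not> touches p (P b)"
    and small: "\<And>x a b. a \<in> C \<Longrightarrow> b \<in> C \<Longrightarrow> a \<noteq> b \<Longrightarrow> touches x (P a) \<Longrightarrow> touches x (P b) \<Longrightarrow>
        (\<exists>S. dominating S \<and> card S < card C)"
    and meet: "\<And>x y a b c d. a \<in> C \<Longrightarrow> b \<in> C \<Longrightarrow> c \<in> C \<Longrightarrow> d \<in> C \<Longrightarrow> touches x (P a) \<Longrightarrow>
        touches x (P b) \<Longrightarrow> touches y (P c) \<Longrightarrow> touches y (P d) \<Longrightarrow> a \<noteq> b \<Longrightarrow> c \<noteq> d \<Longrightarrow>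
        {a, b} \<inter> {c, d} \<noteq> {}"
    using assms unfolding anticomplete_cells_def by meson+
  have finC: "finite C" using domC finite_V finite_subset unfolding dominating_def by blast
  have toucher: "\<exists>d\<in>X. touches d (P a)" if "a \<in> C" "meets_or_covers X (P a)" for a X
    using that ne[of a] adj_sym unfolding meets_or_covers_def covers_def touches_def by blast
  show ?thesis
  proof (cases "\<exists>x. \<exists>a\<in>C. \<exists>b\<in>C. a \<noteq> b \<and> touches x (P a) \<and> touches x (P b)")
    case False
    have "card C * m \<le> (\<Sum>h\<in>W. card (D h))"
    proof (rule cell_bound[where S = P])
      fix X assume "X \<subseteq> V"
      then have fX: "finite X" using finite_V finite_subset by blast
      have "\<forall>a\<in>{a \<in> C. meets_or_covers X (P a)}. \<exists>d\<in>X. touches d (P a)"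
        using toucher by blast
      then obtain f where f: "\<And>a. a \<in> C \<Longrightarrow> meets_or_covers X (P a) \<Longrightarrow> f a \<in> X \<and> touches (f a) (P a)"
        by (metis (no_types, lifting) mem_Collect_eq)
      have "inj_on f {a \<in> C. meets_or_covers X (P a)}"
        by (rule inj_onI) (use f False in \<open>metis (no_types, lifting) mem_Collect_eq\<close>)
      then show "card {a \<in> C. meets_or_covers X (P a)} \<le> card X"
        by (rule card_inj_on_le) (use f fX in auto)
    qed (use ne finC in auto)
    moreover have "g \<le> card C" using g_le domC by blast
    ultimately show ?thesis by (meson le_trans mult_le_mono1)
  next
    case True
    then obtain x a b where ab: "a \<in> C" "b \<in> C" "a \<noteq> b" "touches x (P a)" "touches x (P b)"
      by blast
    define S where "S = (\<lambda>i. if i = a then P a \<union> P b else P i)"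
    define I where "I = C - {b}"
    have I: "a \<in> I" "I \<subseteq> C" "b \<notin> I" "finite I" using ab finC unfolding I_def by auto
    have "card I * m \<le> (\<Sum>h\<in>W. card (D h))"
    proof (rule cell_bound[where S = S])
      fix X assume "X \<subseteq> V"
      then have fX: "finite X" using finite_V finite_subset by blast
      define J where "J = {i \<in> I. meets_or_covers X (S i)}"
      have fJ: "finite J" "J \<subseteq> I" using I unfolding J_def by auto
      have "\<forall>i\<in>J - {a}. \<exists>d\<in>X. touches d (P i)"
        using toucher I unfolding J_def S_def by auto
      then obtain f where f: "\<And>i. i \<in> J - {a} \<Longrightarrow> f i \<in> X \<and> touches (f i) (P i)"
        by metis
      \<comment> \<open>An element touching two further cells would give a touched pair of indices
        disjoint from \<open>{a, b}\<close>.\<close>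
      have inj: "inj_on f (J - {a})"
      proof (rule inj_onI, rule ccontr)
        fix i j assume ij: "i \<in> J - {a}" "j \<in> J - {a}" "f i = f j" "i \<noteq> j"
        then have "{a, b} \<inter> {i, j} \<noteq> {}"
          using meet[of a b i j x "f i"] f[of i] f[of j] ab fJ I by auto
        then show False using ij fJ I by auto
      qed
      have le: "card (J - {a}) \<le> card X"
        by (rule card_inj_on_le[OF inj]) (use f fX in auto)
      show "card {i \<in> I. meets_or_covers X (S i)} \<le> card X"
      proof (cases "a \<in> J")
        case True
        \<comment> \<open>The merged cell has to be paid for by an element of \<open>X\<close> that
          is not already assigned to another cell.\<close>
        have "f ` (J - {a}) \<noteq> X"
        proof
          assume X: "f ` (J - {a}) = X"
          have ex: "\<exists>i\<in>J - {a}. d = f i" if "d \<in> X" for d using that X by blast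
          have "meets_or_covers X (P a \<union> P b)"
            using True unfolding J_def S_def by simp
          then consider p where "p \<in> X" "p \<in> P a \<union> P b"
            | "X \<inter> (P a \<union> P b) = {}" "\<forall>x\<in>P a \<union> P b. covers X x"
            unfolding meets_or_covers_def by blast
          then show False
          proof cases
            case 1
            then obtain i where i: "i \<in> J - {a}" "p = f i" using ex by blast
            then have "touches p (P i)" "i \<in> C" "i \<noteq> a" "i \<noteq> b" using f fJ I by auto
            then show False using anti 1 ab by blast
          next
            case 2
            \<comment> \<open>If \<open>d\<close> covers \<open>pa\<close> and \<open>e\<close>
              covers \<open>pb\<close>, and both are assigned to other cells \<open>i\<close> and
              \<open>j\<close>, the touched pairs \<open>{a, i}\<close> and \<open>{b, j}\<close>
              intersect, so \<open>i = j\<close> and \<open>d = e\<close>. This vertex then sees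
              three pairwise nonadjacent vertices, a claw.\<close>
            obtain pa pb where p: "pa \<in> P a" "pb \<in> P b" using ne ab by blast
            obtain d where d: "d \<in> X" "E pa d" using 2 p unfolding covers_def by blast
            obtain e where e: "e \<in> X" "E pb e" using 2 p unfolding covers_def by blast
            obtain i where i: "i \<in> J - {a}" "d = f i" using ex d by blast
            obtain j where j: "j \<in> J - {a}" "e = f j" using ex e by blast
            have ij: "i \<in> C" "i \<noteq> a" "i \<noteq> b" "j \<in> C" "j \<noteq> a" "j \<noteq> b" using i j fJ I by auto
            have t: "touches d (P a)" "touches d (P i)" "touches e (P b)" "touches e (P j)"
              using d e p i j f adj_sym unfolding touches_def by blast+
            have "i = j"
              using meet[of a i b j d e] ij ab t by auto
            then have "d = e" using i j by simp
            obtain q where q: "q \<in> P i" "d = q \<or> E d q" using t unfolding touches_def by blast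
            have "d \<noteq> q" using anti[of i a q] t q ij ab by blast
            then have "E d q" using q by blast
            moreover have "E d pa" "E d pb" using d e \<open>d = e\<close> adj_sym by auto
            moreover have "\<not> E pa pb" "pa \<noteq> pb" "\<not> E pa q" "pa \<noteq> q" "\<not> E pb q" "pb \<noteq> q"
              using anti[of a b pa] anti[of a i pa] anti[of b i pb] ab ij p q
              unfolding touches_def by auto
            ultimately show False using claw by blast
          qed
        qed
        then have "f ` (J - {a}) \<subset> X" using f by blast
        then have "card (f ` (J - {a})) < card X" using fX psubset_card_mono by blast
        then have "card (J - {a}) < card X" using card_image[OF inj] by simp
        then have "card J \<le> card X" using True fJ by (simp add: card_Diff_singleton)
        then show ?thesis unfolding J_def .
      next
        case False
        then show ?thesis using le unfolding J_def by simp
      qed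
    qed (use ne ab I in \<open>auto simp: S_def\<close>)
    moreover have "g \<le> card I"
    proof -
      obtain S where "dominating S" "card S < card C" using small ab by blast
      then show ?thesis using g_le[of S] ab finC unfolding I_def by (simp add: card_Diff_singleton)
    qed
    ultimately show ?thesis by (meson le_trans mult_le_mono1)
  qed
qed

text \<open>
  With \<open>V - N[v]\<close> split into cliques \<open>Q True\<close> and \<open>Q False\<close>, colour \<open>None\<close> stands for \<open>N[v]\<close> and colour
  \<open>Some b\<close> for \<open>Q b\<close>. A fibre \<open>D h\<close> can afford \<open>|D h|\<close> colours. Usually this pays for all cliques it
  dominates and for \<open>None\<close> if it meets \<open>N[v]\<close>; the flexible fibres are one short. Such a fibre
  either gives up \<open>None\<close> or a clique which it dominates without meeting it. The second option is taken
  on a maximal independent set of the flexible \<open>h\<close> with no neighbour already coloured \<open>None\<close>; by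
  \<open>compat\<close>, the colour given up there is found on a flexible neighbour.
\<close>
lemma bound_if_two_clique_cover:
  assumes two_clique_cover
  shows "g * m \<le> (\<Sum>h\<in>W. card (D h))"
proof (cases "g \<le> 2")
  case True
  then show ?thesis by (rule bound_if_le_2)
next
  case False
  obtain v A B where v: "v \<in> V" and AB: "clique A" "clique B"
      "\<And>x. x \<in> V \<Longrightarrow> x = v \<or> E v x \<or> x \<in> A \<or> x \<in> B"
    using assms unfolding two_clique_cover_def by blast
  define N where "N = {x \<in> V. x = v \<or> E v x}"
  \<comment> \<open>The two cliques are made disjoint from \<open>N\<close> and from each
    other.\<close>
  define Q where "Q b = (if b then A - N else B - A - N)" for b
  have Q_clique: "x = y \<or> E x y" if "x \<in> Q b" "y \<in> Q b" for x y b
    using that AB unfolding Q_def clique_def by (auto split: if_splits)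
  have Q_disj: "b = b'" if "x \<in> Q b" "x \<in> Q b'" for x b b'
    using that unfolding Q_def by (auto split: if_splits)
  have Q_N: "x \<notin> N" if "x \<in> Q b" for x b using that unfolding Q_def by (auto split: if_splits)
  have Q_V: "Q b \<subseteq> V" for b using AB unfolding Q_def clique_def by auto
  have cases_V: "x \<in> N \<or> (\<exists>b. x \<in> Q b)" if "x \<in> V" for x
    using AB(3)[OF that] that unfolding N_def Q_def by (auto split: if_splits)
  have vN: "v \<in> N" "N \<subseteq> V" using v unfolding N_def by auto
  \<comment> \<open>\<open>MT X\<close> collects the cliques dominated by \<open>X\<close>, an empty
    one included; \<open>Ht X\<close> collects those that \<open>X\<close> meets.\<close>
  define MT where "MT X = {b. \<forall>x\<in>Q b. covers X x}" for X
  define Ht where "Ht X = {b. X \<inter> Q b \<noteq> {}}" for X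
  have Ht_MT: "Ht X \<subseteq> MT X" for X
    using Q_clique unfolding Ht_def MT_def covers_def by blast
  have MT_card: "card M \<le> 2" for M :: "bool set"
    using card_mono[of "UNIV :: bool set" M] by simp
  \<comment> \<open>If \<open>X\<close> dominates \<open>N\<close>, one vertex from each clique
    outside \<open>MT X\<close> completes it to a dominating set.\<close>
  have complete: "\<exists>S. dominating S \<and> card S + card (MT X) \<le> card X + 2"
    if X: "X \<subseteq> V" "\<forall>x\<in>N. covers X x" for X
  proof -
    have "\<forall>b\<in>- MT X. \<exists>x. x \<in> Q b" unfolding MT_def by auto
    then obtain r where r: "\<And>b. b \<notin> MT X \<Longrightarrow> r b \<in> Q b" by (metis ComplI)
    let ?S = "X \<union> r ` (- MT X)"
    have "dominating ?S"
      unfolding dominating_def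
    proof (intro conjI ballI)
      show "?S \<subseteq> V" using X r Q_V by blast
      fix x assume "x \<in> V"
      then consider "x \<in> N" | b where "x \<in> Q b" using cases_V by blast
      then show "covers ?S x"
      proof cases
        case 1
        then show ?thesis using X covers_mono by blast
      next
        case (2 b)
        show ?thesis
        proof (cases "b \<in> MT X")
          case True
          then have "covers X x" using 2 unfolding MT_def by blast
          then show ?thesis by (rule covers_mono) blast
        next
          case False
          then show ?thesis using Q_clique[OF 2 r] unfolding covers_def by blast
        qed
      qed
    qed
    moreover have "card ?S \<le> card X + card (r ` (- MT X))" by (rule card_Un_le)
    moreover have "card (r ` (- MT X)) \<le> card (- MT X)" by (rule card_image_le) simp
    moreover have "card (- MT X) + card (MT X) = 2"
      using card_Un_disjoint[of "- MT X" "MT X"] by (simp add: Un_commute)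
    ultimately show ?thesis by (intro exI[of _ ?S]) auto
  qed
  have g3: "g \<le> 3"
  proof -
    have "\<forall>x\<in>N. covers {v} x" using adj_sym unfolding N_def covers_def by blast
    then obtain S where "dominating S" "card S \<le> card {v} + 2"
      using complete[of "{v}"] v by auto
    then show ?thesis using g_le[of S] by simp
  qed
  have MT_lt: "card (MT X) < card X" if X: "X \<subseteq> V" "\<forall>x\<in>N. covers X x" for X
  proof -
    obtain S where S: "dominating S" "card S + card (MT X) \<le> card X + 2"
      using complete[OF X] by blast
    show ?thesis using g_le[OF S(1)] S(2) False by linarith
  qed
  have MT_le: "card (MT X) \<le> card X" if X: "X \<subseteq> V" for X
  proof -
    \<comment> \<open>Adding \<open>v\<close> makes all of \<open>N\<close> dominated at the cost of
      one element, and \<open>MT_lt\<close> gains one.\<close>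
    have "\<forall>x\<in>N. covers (insert v X) x" using adj_sym unfolding N_def covers_def by blast
    then have "card (MT (insert v X)) < card (insert v X)" using MT_lt X v by blast
    moreover have "card (MT X) \<le> card (MT (insert v X))"
      by (rule card_mono) (auto simp: MT_def intro: covers_mono)
    moreover have "card (insert v X) \<le> Suc (card X)"
      by (rule card_insert_le_m1[of "Suc (card X)", simplified]) simp_all
    ultimately show ?thesis by linarith
  qed
  \<comment> \<open>The fibres that meet \<open>N\<close> but cannot afford \<open>None\<close> on
    top of all cliques they dominate.\<close>
  define flex where "flex X \<longleftrightarrow> X \<subseteq> V \<and> X \<inter> N \<noteq> {} \<and> card X \<le> card (MT X)" for X
  have flex_uncovered: "\<exists>e\<in>N. \<not> covers X e" if "flex X" for X
    using that MT_lt[of X] unfolding flex_def by (meson not_le)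
  have flex_card: "card X = card (MT X)" if "flex X" for X
    using that MT_le[of X] unfolding flex_def by simp
  \<comment> \<open>Elements of \<open>X\<close> in distinct cliques are distinct and lie outside
    \<open>N\<close>, while \<open>X\<close> also has an element in \<open>N\<close>. So
    \<open>X\<close> meets fewer cliques than it dominates.\<close>
  have flex_free: "\<exists>t. t \<in> MT X \<and> t \<notin> Ht X" if "flex X" for X
  proof (rule ccontr)
    assume "\<not> ?thesis"
    then have "Ht X = MT X" using Ht_MT by blast
    have X: "X \<subseteq> V" "finite X" "X \<inter> N \<noteq> {}"
      using that finite_V finite_subset unfolding flex_def by blast+
    have "\<forall>b\<in>Ht X. \<exists>x. x \<in> X \<inter> Q b" unfolding Ht_def by blast
    then obtain f where f: "\<And>b. b \<in> Ht X \<Longrightarrow> f b \<in> X \<inter> Q b" by metis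
    have "card (Ht X) \<le> card (X - N)"
    proof (rule card_inj_on_le[where f = f])
      show "inj_on f (Ht X)"
      proof (rule inj_onI)
        fix i j assume "i \<in> Ht X" "j \<in> Ht X" "f i = f j"
        then show "i = j" using f[of i] f[of j] Q_disj[of "f i" i j] by simp
      qed
      show "f ` Ht X \<subseteq> X - N" using f Q_N by blast
    qed (use X in simp)
    also have "\<dots> < card X" by (rule psubset_card_mono) (use X in auto)
    finally show False using \<open>Ht X = MT X\<close> that unfolding flex_def by simp
  qed
  have singleton: "M = {b}" if "b \<in> M" "(\<not> b) \<notin> M" for b and M :: "bool set"
  proof -
    have "x \<in> M \<longleftrightarrow> x = b" for x using that by (cases x; cases b) auto
    then show ?thesis by blast
  qed
  \<comment> \<open>Otherwise \<open>Y = {e}\<close> and \<open>MT Y = {q'}\<close>. If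
    \<open>q' \<in> MT X\<close>, then \<open>X\<close> meets that clique in a vertex seen by
    \<open>e\<close>, although \<open>X\<close> does not cover \<open>e\<close>. If not,
    \<open>X = {d}\<close>, and \<open>{d, e}\<close> dominates: the two cliques are covered by one
    vertex each, and the neighbours of \<open>v\<close> by claw-freeness at \<open>v\<close>. This
    contradicts \<open>g > 2\<close>.\<close>
  have compat: "\<exists>t. t \<in> MT X \<and> t \<notin> Ht X \<and> t \<in> MT Y"
    if X: "flex X" and Y: "flex Y" and e: "e \<in> Y" "e \<in> N" "\<not> covers X e" for X Y e
  proof (rule ccontr)
    assume no: "\<not> ?thesis"
    obtain q where q: "q \<in> MT X" "q \<notin> Ht X" using flex_free X by blast
    obtain q' where q': "q' \<in> MT Y" "q' \<notin> Ht Y" using flex_free Y by blast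
    have "q \<notin> MT Y" using no q by blast
    then have "q' = (\<not> q)" using q' by (cases q; cases q') auto
    then have "MT Y = {q'}" using singleton[of q' "MT Y"] q' \<open>q \<notin> MT Y\<close> by simp
    then have "card Y = 1" using flex_card[OF Y] by simp
    then have "Y = {e}" using e(1) by (metis card_1_singletonE singletonD)
    show False
    proof (cases "q' \<in> MT X")
      case True
      then have "q' \<in> Ht X" using no q' by blast
      then obtain y where y: "y \<in> X" "y \<in> Q q'" unfolding Ht_def by blast
      then have "covers {e} y" using q' \<open>Y = {e}\<close> unfolding MT_def by blast
      then show False using y e adj_sym unfolding covers_def by blast
    next
      case False
      then have "MT X = {q}" using singleton[of q "MT X"] q \<open>q' = (\<not> q)\<close> by simp
      moreover obtain d where d: "d \<in> X" "d \<in> N" using X unfolding flex_def by blast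
      moreover from calculation have "card X = 1" using flex_card[OF X] by simp
      ultimately have "X = {d}" by (metis card_1_singletonE singletonD)
      have de: "\<not> E d e" "d \<noteq> e" using e(3) d adj_sym unfolding covers_def by blast+
      have "E v d" "E v e"
        using d e de adj_sym unfolding N_def by blast+
      have "dominating {d, e}"
        unfolding dominating_def
      proof (intro conjI ballI)
        show "{d, e} \<subseteq> V" using d e vN by blast
        fix x assume "x \<in> V"
        then consider "x = v" | "E v x" "x \<noteq> v" | b where "x \<in> Q b" using cases_V unfolding N_def by blast
        then show "covers {d, e} x"
        proof cases
          case 1
          then show ?thesis using \<open>E v d\<close> unfolding covers_def by blast
        next
          case 2
          then show ?thesis
            using claw[OF \<open>E v d\<close> \<open>E v e\<close> \<open>E v x\<close>] de adj_sym unfolding covers_def by blast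
        next
          case (3 b)
          then have "covers X x \<or> covers Y x"
            using q(1) q'(1) \<open>q' = (\<not> q)\<close> unfolding MT_def by (cases "b = q") auto
          then show ?thesis using \<open>X = {d}\<close> \<open>Y = {e}\<close> covers_mono by blast
        qed
      qed
      then show False using g_le[of "{d, e}"] False \<open>\<not> g \<le> 2\<close> card_insert_le_m1[of 2 "{e}" d] by simp
    qed
  qed
  define Fl where "Fl = {h \<in> W. flex (D h)}"
  \<comment> \<open>\<open>C0\<close> consists of the fibres that can pay for \<open>None\<close>
    and for every clique they dominate. \<open>R\<close> consists of the flexible ones without a
    neighbour in \<open>C0\<close>.\<close>
  define C0 where "C0 = {h \<in> W. D h \<inter> N \<noteq> {} \<and> h \<notin> Fl}"
  define R where "R = {h \<in> Fl. \<forall>k\<in>C0. \<not> F h k}"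
  have Fl_W: "Fl \<subseteq> W" "finite Fl" using finite_W unfolding Fl_def by auto
  define Ind where "Ind = {I. I \<subseteq> R \<and> (\<forall>h\<in>I. \<forall>k\<in>I. \<not> F h k)}"
  have "finite Ind"
    by (rule finite_subset[of _ "Pow Fl"]) (auto simp: Ind_def R_def Fl_W)
  moreover have "{} \<in> Ind" unfolding Ind_def by auto
  ultimately obtain I where "I \<in> Ind" and I_max: "\<And>J. J \<in> Ind \<Longrightarrow> I \<subseteq> J \<Longrightarrow> J = I"
    using finite_has_maximal2 by (metis (no_types, lifting))
  then have I: "I \<subseteq> R" "\<And>h k. h \<in> I \<Longrightarrow> k \<in> I \<Longrightarrow> \<not> F h k" unfolding Ind_def by auto
  have I_nbr: "\<exists>k\<in>I. F h k" if "h \<in> R" "h \<notin> I" for h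
  proof (rule ccontr)
    assume "\<not> ?thesis"
    then have "insert h I \<in> Ind" using I that F_sym F_irrefl unfolding Ind_def by blast
    then show False using I_max that by blast
  qed
  \<comment> \<open>A vertex of \<open>N\<close> not covered by \<open>D h\<close> lies in a
    neighbouring fibre. That fibre meets \<open>N\<close> but is not in \<open>C0\<close>, so it is
    flexible and \<open>compat\<close> applies.\<close>
  have "\<forall>h\<in>R. \<exists>t. t \<in> MT (D h) \<and> t \<notin> Ht (D h) \<and> (\<exists>k\<in>Fl. F h k \<and> t \<in> MT (D k))"
  proof
    fix h assume h: "h \<in> R"
    then have hW: "h \<in> W" "flex (D h)" unfolding R_def Fl_def by auto
    then obtain e where e: "e \<in> N" "\<not> covers (D h) e" using flex_uncovered by blast
    then obtain k where k: "k \<in> W" "F h k" "e \<in> D k" using D_covers hW vN by blast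
    then have "k \<in> Fl" using h e unfolding R_def C0_def by blast
    then show "\<exists>t. t \<in> MT (D h) \<and> t \<notin> Ht (D h) \<and> (\<exists>k\<in>Fl. F h k \<and> t \<in> MT (D k))"
      using compat[of "D h" "D k" e] hW k e unfolding Fl_def by blast
  qed
  then obtain tt where tt: "\<And>h. h \<in> R \<Longrightarrow> tt h \<in> MT (D h) \<and> tt h \<notin> Ht (D h) \<and>
      (\<exists>k\<in>Fl. F h k \<and> tt h \<in> MT (D k))"
    by metis
  define c where "c h = (if h \<in> I then insert None (Some ` (MT (D h) - {tt h}))
    else if h \<in> C0 then insert None (Some ` MT (D h)) else Some ` MT (D h))" for h
  have "card (UNIV :: bool option set) * m \<le> (\<Sum>h\<in>W. card (D h))"
  proof (rule colouring_bound[where c = c])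
    fix i :: "bool option" and h assume h: "h \<in> W"
    show "i \<in> c h \<or> (\<exists>k\<in>W. F h k \<and> i \<in> c k)"
    proof (cases i)
      case None
      consider "h \<in> I" | "h \<in> C0" | "D h \<inter> N = {}" | "h \<in> Fl" "h \<notin> I"
        using h unfolding C0_def by blast
      then show ?thesis
      proof cases
        case 1
        then show ?thesis using None unfolding c_def by simp
      next
        case 2
        then show ?thesis using None unfolding c_def by simp
      next
        case 3
        \<comment> \<open>The vertex \<open>v\<close> must be found in a neighbouring fibre.
          Containing \<open>v\<close>, that fibre dominates \<open>N\<close>, so it is not flexible
          and has colour \<open>None\<close>.\<close>
        then have "\<not> covers (D h) v"
          using D_V h adj_sym vN unfolding covers_def N_def by blast
        then obtain k where k: "k \<in> W" "F h k" "v \<in> D k" using D_covers h v by blast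
        have "\<forall>x\<in>N. covers (D k) x" using k(3) adj_sym unfolding covers_def N_def by blast
        then have "\<not> flex (D k)" using flex_uncovered by blast
        then have "k \<in> C0" using k vN unfolding C0_def Fl_def by blast
        then show ?thesis using None k unfolding c_def by auto
      next
        case 4
        then have "(\<exists>k\<in>C0. F h k) \<or> (\<exists>k\<in>I. F h k)"
          using I_nbr unfolding R_def by blast
        then show ?thesis using None I unfolding c_def R_def Fl_def C0_def by auto
      qed
    next
      case (Some b)
      \<comment> \<open>A colour is given up only when its clique is not met, so a met clique always
        keeps its colour.\<close>
      have Ht_c: "Some b \<in> c k" if "b \<in> Ht (D k)" "k \<in> W" for k
        using that Ht_MT tt[of k] I(1) unfolding c_def by auto
      consider "b \<notin> MT (D h)" | "b \<in> MT (D h)" "h \<notin> I \<or> b \<noteq> tt h" | "h \<in> I" "b = tt h" by blast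
      then show ?thesis
      proof cases
        case 1
        then obtain y where y: "y \<in> Q b" "\<not> covers (D h) y" unfolding MT_def by blast
        then obtain k where k: "k \<in> W" "F h k" "y \<in> D k" using D_covers h Q_V by blast
        then have "b \<in> Ht (D k)" using y unfolding Ht_def by blast
        then show ?thesis using Ht_c k Some by blast
      next
        case 2
        then show ?thesis using Some unfolding c_def by auto
      next
        case 3
        then obtain k where k: "k \<in> Fl" "F h k" "b \<in> MT (D k)" using tt I(1) by blast
        \<comment> \<open>By independence of \<open>I\<close> the neighbour \<open>k\<close> has
          given up nothing.\<close>
        then have "k \<notin> I" using I 3 by blast
        then have "Some b \<in> c k" using k unfolding c_def by auto
        then show ?thesis using k Fl_W Some by blast
      qed
    qed
  next
    fix h assume h: "h \<in> W"
    have fin: "finite M" for M :: "bool set" by simp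
    have Some_card: "card (Some ` M) = card M" for M :: "bool set"
      by (rule card_image) simp
    have ins_card: "card (insert None (Some ` M)) = Suc (card M)" for M :: "bool set"
      using fin[of M] by (simp add: Some_card image_iff card_insert_if)
    have "card (c h) \<le> card (D h)"
    proof -
      consider "h \<in> I" | "h \<notin> I" "h \<in> C0" | "h \<notin> I" "h \<notin> C0" by blast
      then show ?thesis
      proof cases
        case 1
        then have "h \<in> R" using I by blast
        then have "Suc (card (MT (D h) - {tt h})) = card (MT (D h))"
          using tt fin by (metis card_Suc_Diff1)
        moreover have "card (MT (D h)) = card (D h)"
          using flex_card \<open>h \<in> R\<close> unfolding R_def Fl_def by simp
        ultimately show ?thesis using 1 ins_card unfolding c_def by simp
      next
        case 2
        then have "\<not> flex (D h)" "D h \<inter> N \<noteq> {}" unfolding C0_def Fl_def by auto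
        then have "card (MT (D h)) < card (D h)" using D_V h unfolding flex_def by auto
        then show ?thesis using 2 ins_card unfolding c_def by simp
      next
        case 3
        then show ?thesis using MT_le D_V h Some_card unfolding c_def by simp
      qed
    qed
    then show "card {i \<in> UNIV. i \<in> c h} \<le> card (D h)" by simp
  qed simp
  moreover have "card (UNIV :: bool option set) = 3" by (simp add: UNIV_option_conv card_image card_insert_if image_iff)
  ultimately have "3 * m \<le> (\<Sum>h\<in>W. card (D h))" by simp
  then show ?thesis using g3 by (meson le_trans mult_le_mono1)
qed

end

section \<open>Structure of connected graphs without induced claw and 6-vertex path\<close>

text \<open>In \<open>P6\<close> the six vertices are distinct by virtue of the listed adjacencies
  and nonadjacencies.\<close>

locale claw_P6_free_graph = claw_free_graph +
  assumes P6: "E a b \<Longrightarrow> E b c \<Longrightarrow> E c d \<Longrightarrow> E d e \<Longrightarrow> E e f \<Longrightarrow>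
      \<not> E a c \<Longrightarrow> \<not> E a d \<Longrightarrow> \<not> E a e \<Longrightarrow> \<not> E a f \<Longrightarrow> \<not> E b d \<Longrightarrow> \<not> E b e \<Longrightarrow> \<not> E b f \<Longrightarrow>
      \<not> E c e \<Longrightarrow> \<not> E c f \<Longrightarrow> \<not> E d f \<Longrightarrow> False"
    and conn_V: "conn V"
begin

section \<open>Induced 6-cycles\<close>

definition C6 :: "'a \<Rightarrow> 'a \<Rightarrow> 'a \<Rightarrow> 'a \<Rightarrow> 'a \<Rightarrow> 'a \<Rightarrow> bool" where
  "C6 a b c d e f \<longleftrightarrow> E a b \<and> E b c \<and> E c d \<and> E d e \<and> E e f \<and> E f a \<and>
     \<not> E a c \<and> \<not> E a d \<and> \<not> E a e \<and> \<not> E b d \<and> \<not> E b e \<and> \<not> E b f \<and>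
     \<not> E c e \<and> \<not> E c f \<and> \<not> E d f"

lemma C6_rotate: "C6 a b c d e f \<Longrightarrow> C6 b c d e f a"
  unfolding C6_def by (auto simp: adj_commute)

lemma C6_distinct: "C6 a b c d e f \<Longrightarrow> distinct [a, b, c, d, e, f]"
  unfolding C6_def using adj_sym adj_irrefl by auto

text \<open>Claw-freeness at \<open>x\<close>, with \<open>y\<close> as a leaf, keeps
  \<open>x\<close> away from \<open>c\<close>, \<open>d\<close>, \<open>e\<close> and from one of
  \<open>b\<close>, \<open>f\<close>; claw-freeness at \<open>a\<close> makes \<open>x\<close> see
  the other one. Going round the cycle on the unseen side gives an induced path on six vertices
  starting at \<open>x\<close>.\<close>

lemma C6_private:
  assumes C: "C6 a b c d e f" and x: "E x a" and y: "E x y"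
    and ny: "\<not> E y a" "\<not> E y b" "\<not> E y c" "\<not> E y d" "\<not> E y e" "\<not> E y f"
    and x': "x \<notin> {a, b, c, d, e, f}"
  shows False
proof -
  note di = C6_distinct[OF C, simplified]
  have yy: "y \<notin> {a, b, c, d, e, f}"
    using C ny adj_sym unfolding C6_def by blast
  have xp: "\<not> E x q" if "q \<in> {c, d, e}" for q
    using claw_nonadj[of x y a q] x y ny that C yy di adj_sym unfolding C6_def by blast
  have "E x b \<or> E x f"
    using claw_nonadj[of a x b f] x x' C di adj_sym unfolding C6_def by blast
  then show False
  proof
    assume b: "E x b"
    then have "\<not> E x f"
      using claw_nonadj[of x y b f] y ny C yy di adj_sym unfolding C6_def by blast
    then show False
      using P6[of x a f e d c] x xp C unfolding C6_def by (simp add: adj_commute)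
  next
    assume f: "E x f"
    then have "\<not> E x b"
      using claw_nonadj[of x y b f] y ny C yy di adj_sym unfolding C6_def by blast
    then show False
      using P6[of x a b c d e] x xp C unfolding C6_def by (simp add: adj_commute)
  qed
qed

text \<open>Otherwise connectivity gives an edge from a vertex dominated by the cycle to an
  undominated one, which \<open>C6_private\<close> excludes for each rotation of the cycle.\<close>

lemma C6_dominating:
  assumes C: "C6 a b c d e f" and w: "w \<in> V" "w \<notin> {a, b, c, d, e, f}"
  shows "\<exists>q\<in>{a, b, c, d, e, f}. E w q"
proof (rule ccontr)
  assume nw: "\<not> ?thesis"
  let ?Z = "{a, b, c, d, e, f}"
  define N where "N = {x \<in> V. covers ?Z x}"
  have "a \<in> N" using C adj_V unfolding N_def covers_def C6_def by blast
  moreover have "w \<notin> N" using nw w unfolding N_def covers_def by blast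
  ultimately have "N \<noteq> {}" "N \<noteq> V" "N \<subseteq> V" using w unfolding N_def by auto
  then obtain x y where xy: "x \<in> N" "y \<in> V - N" "E x y"
    using conn_V unfolding conn_def by meson
  have ny: "\<not> E y q" if "q \<in> ?Z" for q using xy that unfolding N_def covers_def by blast
  have x': "x \<notin> ?Z" using xy ny adj_sym by blast
  then obtain q where q: "q \<in> ?Z" "E x q" using xy unfolding N_def covers_def by blast
  note C2 = C6_rotate[OF C] note C3 = C6_rotate[OF C2] note C4 = C6_rotate[OF C3]
  note C5 = C6_rotate[OF C4] note C6' = C6_rotate[OF C5]
  show False
    using q(1) C6_private[OF C _ xy(3)] C6_private[OF C2 _ xy(3)] C6_private[OF C3 _ xy(3)]
      C6_private[OF C4 _ xy(3)] C6_private[OF C5 _ xy(3)] C6_private[OF C6' _ xy(3)] q(2) ny x'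
    by auto
qed

text \<open>Two nonadjacent members and \<open>v\<close> would be the leaves of a claw at
  \<open>a\<close>.\<close>

lemma clique_nbhd_diff:
  assumes "E v a"
  shows "clique {x \<in> V. E a x \<and> x \<noteq> v \<and> \<not> E v x}"
  unfolding clique_def
proof (intro conjI ballI impI)
  fix x y assume "x \<in> {x \<in> V. E a x \<and> x \<noteq> v \<and> \<not> E v x}" "y \<in> {x \<in> V. E a x \<and> x \<noteq> v \<and> \<not> E v x}" "x \<noteq> y"
  then show "E x y" using claw[of a v x y] assms adj_sym by auto
qed auto

text \<open>Take \<open>a\<close> as the centre. The neighbours of \<open>b\<close> outside the
  closed neighbourhood of \<open>a\<close> form one clique, and the vertices that see neither
  \<open>a\<close> nor \<open>b\<close> form the other.\<close>

lemma two_clique_cover_if_C6: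
  assumes C: "C6 a b c d e f"
  shows two_clique_cover
proof -
  note di = C6_distinct[OF C, simplified]
  note C' = C[unfolded C6_def]
  define B where "B = {x \<in> V. x \<noteq> a \<and> \<not> E a x \<and> \<not> E b x}"
  \<comment> \<open>Claws at \<open>c\<close>, \<open>d\<close>, \<open>e\<close>, \<open>f\<close>
    and paths running round the cycle determine how a vertex of \<open>B\<close> is
    attached.\<close>
  have cases_B: "x = d \<or> x = e \<or> (E x d \<and> E x e \<and> (E x c \<or> E x f))" if "x \<in> B" for x
  proof (cases "x \<in> {a, b, c, d, e, f}")
    case True
    then show ?thesis using that C' adj_sym unfolding B_def by blast
  next
    case False
    have nx: "\<not> E x a" "\<not> E x b" using that adj_sym unfolding B_def by blast+
    have 1: "E x d" if "E x c" using claw_nonadj[of c b d x] C' that nx False di adj_sym by blast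
    have 2: "E x e" if "E x f" using claw_nonadj[of f a e x] C' that nx False di adj_sym by blast
    have 3: "E x c \<or> E x e" if "E x d" using claw_nonadj[of d c e x] C' that nx False di adj_sym by blast
    have 4: "E x d \<or> E x f" if "E x e" using claw_nonadj[of e d f x] C' that nx False di adj_sym by blast
    have 5: "E x c \<or> E x d \<or> E x e \<or> E x f"
      using C6_dominating[OF C _ False] that nx unfolding B_def by auto
    have 6: "E x e" if "E x c"
    proof (rule ccontr)
      assume "\<not> E x e"
      then show False using P6[of x c b a f e] that nx 2 C' by (auto simp: adj_commute)
    qed
    have 7: "E x d" if "E x f"
    proof (rule ccontr)
      assume "\<not> E x d"
      then show False using P6[of x f a b c d] that nx 1 C' by (auto simp: adj_commute)
    qed
    have 8: "E x c \<or> E x f" if "E x d"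
    proof (rule ccontr)
      assume "\<not> ?thesis"
      then show False using P6[of x d c b a f] that nx C' by (auto simp: adj_commute)
    qed
    show ?thesis using 1 2 3 4 5 6 7 8 by blast
  qed
  have "E x y" if x: "x \<in> B" and y: "y \<in> B" and xy: "x \<noteq> y" for x y
  proof (cases "x \<in> {d, e} \<or> y \<in> {d, e}")
    case True
    then show ?thesis using cases_B[OF x] cases_B[OF y] xy C' adj_sym by auto
  next
    case False
    then have xy': "E x c \<or> E x f" "E y c \<or> E y f" using cases_B x y by blast+
    have n: "\<not> E x a" "\<not> E x b" "\<not> E y a" "\<not> E y b" "x \<noteq> a" "y \<noteq> a" "x \<noteq> b" "y \<noteq> b"
      using x y C' adj_sym unfolding B_def by auto
    \<comment> \<open>A common neighbour \<open>c\<close> or \<open>f\<close> would be the centre of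
      a claw; without one, \<open>x c b a f y\<close> or its mirror image would be an induced
      path.\<close>
    have cc: ?thesis if "E x c" "E y c"
      using claw_nonadj[of c b x y] that C' n xy adj_sym by blast
    have ff: ?thesis if "E x f" "E y f"
      using claw_nonadj[of f a x y] that C' n xy adj_sym by blast
    have cf: ?thesis if "E x c" "\<not> E x f" "E y f" "\<not> E y c"
      by (rule ccontr) (use P6[of x c b a f y] that C' n in \<open>auto simp: adj_commute\<close>)
    have fc: ?thesis if "E y c" "\<not> E y f" "E x f" "\<not> E x c"
      by (rule ccontr) (use P6[of y c b a f x] that C' n in \<open>auto simp: adj_commute\<close>)
    show ?thesis using cc ff cf fc xy' by blast
  qed
  then have "clique B" unfolding clique_def B_def by blast
  moreover have "clique {x \<in> V. E b x \<and> x \<noteq> a \<and> \<not> E a x}"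
    using clique_nbhd_diff C' by blast
  ultimately show ?thesis
    unfolding two_clique_cover_def B_def using C' adj_V by blast
qed

text \<open>Each of the at most two vertices of \<open>X\<close> other than \<open>v\<close>
  dominates only a clique outside the closed neighbourhood of \<open>v\<close>, and these cliques
  cover what \<open>v\<close> leaves.\<close>

lemma two_clique_cover_if_small_hub:
  assumes X: "dominating X" "card X \<le> 3" and v: "v \<in> X" "\<And>x. x \<in> X \<Longrightarrow> x \<noteq> v \<Longrightarrow> E v x"
  shows two_clique_cover
proof -
  have "finite X" "X \<subseteq> V" using X finite_V finite_subset unfolding dominating_def by blast+
  then have "card (X - {v}) \<le> 2" using X v by simp
  then obtain a b where ab: "X - {v} \<subseteq> {a, b}" "a \<in> X" "b \<in> X"
  proof -
    have "\<exists>a b. a \<in> X \<and> b \<in> X \<and> X - {v} \<subseteq> {a, b}"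
    proof -
      consider "card (X - {v}) = 0" | "card (X - {v}) = 1" | "card (X - {v}) = 2"
        using \<open>card (X - {v}) \<le> 2\<close> by linarith
      then show ?thesis
      proof cases
        case 1
        then have "X - {v} = {}" using \<open>finite X\<close> by (metis card_0_eq finite_Diff)
        then show ?thesis using v by blast
      next
        case 2
        then obtain a where "X - {v} = {a}" by (rule card_1_singletonE)
        then show ?thesis by blast
      next
        case 3
        then obtain a b where "X - {v} = {a, b}" by (meson card_2_iff)
        then show ?thesis by blast
      qed
    qed
    then show ?thesis using that by blast
  qed
  \<comment> \<open>If \<open>X - {v}\<close> has fewer than two elements, \<open>a\<close> or
    \<open>b\<close> may be \<open>v\<close>; the clique is then taken to be empty.\<close>
  define Q where "Q a = (if a = v then {} else {x \<in> V. E a x \<and> x \<noteq> v \<and> \<not> E v x})" for a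
  have "clique (Q x)" if "x \<in> X" for x
  proof (cases "x = v")
    case True
    then show ?thesis unfolding Q_def clique_def by simp
  next
    case False
    then have "Q x = {y \<in> V. E x y \<and> y \<noteq> v \<and> \<not> E v y}" unfolding Q_def by simp
    then show ?thesis using clique_nbhd_diff[OF v(2)[OF that False]] by simp
  qed
  then have "clique (Q a)" "clique (Q b)" using ab by blast+
  moreover have "\<forall>x\<in>V. x = v \<or> E v x \<or> x \<in> Q a \<or> x \<in> Q b"
  proof
    fix x assume xV: "x \<in> V"
    show "x = v \<or> E v x \<or> x \<in> Q a \<or> x \<in> Q b"
    proof (cases "x = v \<or> E v x")
      case False
      then have "x \<notin> X" using v by blast
      then obtain d where d: "d \<in> X" "E x d" using X xV unfolding dominating_def covers_def by blast
      then have "d \<noteq> v" using False adj_sym by blast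
      then have "d = a \<or> d = b" using d ab by blast
      then show ?thesis using d \<open>d \<noteq> v\<close> False xV adj_sym unfolding Q_def by auto
    qed auto
  qed
  moreover have "v \<in> V" using v(1) \<open>X \<subseteq> V\<close> by blast
  ultimately show ?thesis
    unfolding two_clique_cover_def by meson
qed

section \<open>Minimum connected dominating sets\<close>

definition min_cds :: "'a set \<Rightarrow> bool" where
  "min_cds X \<longleftrightarrow> conn X \<and> dominating X \<and> X \<noteq> {} \<and>
     (\<forall>Y. conn Y \<longrightarrow> dominating Y \<longrightarrow> Y \<noteq> {} \<longrightarrow> card X \<le> card Y)"

text \<open>The external private neighbours of \<open>a\<close> with respect to
  \<open>X\<close>.\<close>

definition priv :: "'a set \<Rightarrow> 'a \<Rightarrow> 'a set" where
  "priv X a = {p \<in> V - X. E a p \<and> (\<forall>y\<in>X. E p y \<longrightarrow> y = a)}"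

text \<open>Two cliques \<open>insert s Q\<close> and \<open>insert s R\<close> glued at
  \<open>s\<close>, with no other edges between them.\<close>

definition two_star :: "'a set \<Rightarrow> 'a \<Rightarrow> 'a set \<Rightarrow> 'a set \<Rightarrow> bool" where
  "two_star X s Q R \<longleftrightarrow> X = insert s (Q \<union> R) \<and> Q \<noteq> {} \<and> R \<noteq> {} \<and> Q \<inter> R = {} \<and> s \<notin> Q \<union> R \<and>
     clique Q \<and> clique R \<and> (\<forall>x\<in>Q \<union> R. E s x) \<and> (\<forall>x\<in>Q. \<forall>y\<in>R. \<not> E x y)"

lemma two_star_commute: "two_star X s Q R \<Longrightarrow> two_star X s R Q"
  unfolding two_star_def using adj_sym by (simp add: Un_commute Int_commute) blast

lemma min_cds_finite: "min_cds X \<Longrightarrow> finite X"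
  unfolding min_cds_def dominating_def using finite_V finite_subset by blast

lemma min_cds_V: "min_cds X \<Longrightarrow> X \<subseteq> V"
  unfolding min_cds_def dominating_def by blast

lemma min_cds_exists:
  assumes "V \<noteq> {}"
  shows "\<exists>X. min_cds X"
proof -
  have "conn V \<and> dominating V \<and> V \<noteq> {}"
    using conn_V assms unfolding dominating_def covers_def by blast
  then obtain X where "conn X \<and> dominating X \<and> X \<noteq> {}"
      "\<And>Y. conn Y \<and> dominating Y \<and> Y \<noteq> {} \<Longrightarrow> card X \<le> card Y"
    using ex_has_least_nat[of "\<lambda>X. conn X \<and> dominating X \<and> X \<noteq> {}" V card] by blast
  then show ?thesis unfolding min_cds_def by blast
qed

text \<open>By minimality \<open>X - {a}\<close> fails to dominate some vertex. It is not
  \<open>a\<close>, which has a neighbour in \<open>X\<close>, so it lies outside \<open>X\<close>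
  and sees only \<open>a\<close>.\<close>

lemma priv_ne:
  assumes X: "min_cds X" and a: "a \<in> X" "conn (X - {a})" "X \<noteq> {a}"
  shows "priv X a \<noteq> {}"
proof -
  have "card (X - {a}) < card X" using a min_cds_finite[OF X] by (meson card_Diff1_less)
  moreover have "X - {a} \<noteq> {}" using a by blast
  ultimately have "\<not> dominating (X - {a})" using X a unfolding min_cds_def by (meson not_le)
  then obtain p where p: "p \<in> V" "\<not> covers (X - {a}) p"
    using min_cds_V[OF X] unfolding dominating_def by blast
  obtain y where "y \<in> X" "E a y" using conn_adj[of X a] X a unfolding min_cds_def by blast
  then have "p \<noteq> a" using p adj_irrefl unfolding covers_def by blast
  then have "p \<notin> X" using p unfolding covers_def by blast
  moreover have "covers X p" using X p unfolding min_cds_def dominating_def by blast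
  ultimately show ?thesis using p adj_sym unfolding priv_def covers_def by blast
qed

lemma privD:
  assumes "p \<in> priv X a"
  shows "p \<in> V" "p \<notin> X" "E a p" "E p a" "\<And>y. y \<in> X \<Longrightarrow> y \<noteq> a \<Longrightarrow> \<not> E p y \<and> \<not> E y p"
  using assms adj_sym unfolding priv_def by blast+

text \<open>A private neighbour of \<open>a\<close> would complete two nonadjacent neighbours in
  \<open>X\<close> to a claw.\<close>

lemma nbrs_clique:
  assumes X: "min_cds X" and a: "a \<in> X" "conn (X - {a})"
    and xy: "x \<in> X" "y \<in> X" "E a x" "E a y" "x \<noteq> y"
  shows "E x y"
proof -
  obtain p where p: "p \<in> priv X a" using priv_ne[OF X a] xy adj_irrefl by blast
  then show ?thesis using claw[of a x y p] privD[OF p] xy adj_irrefl by metis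
qed

text \<open>Private neighbours of the two ends prolong the path to an induced path on six vertices,
  or close it to an induced 6-cycle if they are adjacent.\<close>

lemma no_P4:
  assumes X: "min_cds X" and no6: "\<And>a b c d e f. \<not> C6 a b c d e f"
    and x: "a \<in> X" "conn (X - {a})" "b \<in> X" "c \<in> X" "d \<in> X" "conn (X - {d})"
    and p: "E a b" "E b c" "E c d" "\<not> E a c" "\<not> E a d" "\<not> E b d"
  shows False
proof -
  have ne: "a \<noteq> b" "a \<noteq> c" "a \<noteq> d" "b \<noteq> c" "b \<noteq> d" "c \<noteq> d"
    using p adj_sym adj_irrefl by blast+
  obtain q where q: "q \<in> priv X a" using priv_ne[OF X] x ne by blast
  obtain r where r: "r \<in> priv X d" using priv_ne[OF X] x ne by blast
  have n: "\<not> E q b" "\<not> E q c" "\<not> E q d" "\<not> E a r" "\<not> E b r" "\<not> E c r" "E q a" "E d r"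
    using privD[OF q] privD[OF r] x ne by blast+
  show False
  proof (cases "E q r")
    case True
    then have "C6 q a b c d r" unfolding C6_def using n p by (simp add: adj_commute)
    then show False using no6 by blast
  next
    case False
    then show False using P6[of q a b c d r] n p by simp
  qed
qed

text \<open>Noncut vertices have private neighbours, so by claw-freeness their neighbourhoods in \<open>X\<close> are
  cliques, and by \<open>P\<^sub>6\<close>-freeness \<open>X\<close> has radius at most two around any of them.\<close>
lemma min_cds_structure:
  assumes X: "min_cds X" and no6: "\<And>a b c d e f. \<not> C6 a b c d e f"
  shows "clique X \<or> (\<exists>s Q R. two_star X s Q R)"
proof -
  have fX: "finite X" and cX: "conn X" and XV: "X \<subseteq> V" "X \<noteq> {}"
    using X min_cds_finite min_cds_V unfolding min_cds_def by blast+
  obtain u where u: "u \<in> X" "conn (X - {u})" using conn_noncut_exists cX fX XV by blast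
  show ?thesis
  proof (cases "X = {u}")
    case True
    then show ?thesis using XV unfolding clique_def by blast
  next
    case Xu: False
    obtain p where p: "p \<in> priv X u" using priv_ne[OF X u Xu] by blast
    \<comment> \<open>\<open>B1\<close>, \<open>B2\<close>, \<open>B3\<close> are the balls of
      radius one, two and three around \<open>u\<close> inside \<open>X\<close>.\<close>
    define L where "L = {y \<in> X. E u y}"
    define B1 where "B1 = insert u L"
    define B2 where "B2 = {x \<in> X. x \<in> B1 \<or> (\<exists>y\<in>L. E x y)}"
    define B3 where "B3 = {x \<in> X. x \<in> B2 \<or> (\<exists>y\<in>B2. E x y)}"
    have sub: "B1 \<subseteq> B2" "B2 \<subseteq> B3" "B3 \<subseteq> X" "u \<in> B1" "L \<subseteq> B1"
      using u unfolding B1_def B2_def B3_def L_def by auto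
    have B2I: "c \<in> B2" if "b \<in> B1" "c \<in> X" "E c b" for b c
    proof (cases "b = u")
      case True
      then have "c \<in> L" using that adj_sym unfolding L_def by blast
      then show ?thesis using sub by blast
    next
      case False
      then show ?thesis using that unfolding B1_def B2_def by blast
    qed
    have L_clique: "E x y" if "x \<in> L" "y \<in> L" "x \<noteq> y" for x y
      using nbrs_clique[OF X u] that unfolding L_def by blast
    have c1: "conn B1" by (rule conn_hub[OF conn_singleton[of u]]) (auto simp: B1_def L_def adj_sym)
    have c1': "conn (B1 - {t})" if "t \<noteq> u" for t
      by (rule conn_hub[OF conn_singleton[of u]]) (use that in \<open>auto simp: B1_def L_def adj_sym\<close>)
    have c2: "conn B2" by (rule conn_hub[OF c1]) (use sub in \<open>auto simp: B2_def\<close>)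
    have "B3 = X"
    proof (rule ccontr)
      assume "B3 \<noteq> X"
      moreover have "B3 \<noteq> {}" using sub by blast
      \<comment> \<open>Here \<open>d\<close> has distance four from \<open>u\<close>; a private
        neighbour of \<open>u\<close> prolongs \<open>u a b c d\<close> to an induced path on six
        vertices.\<close>
      ultimately obtain c d where cd: "c \<in> B3" "d \<in> X - B3" "E c d"
        using cX sub unfolding conn_def by meson
      then have "c \<notin> B2" unfolding B3_def using adj_sym by blast
      then obtain b where b: "b \<in> B2" "E c b" using cd unfolding B3_def by blast
      then have "b \<notin> B1" using \<open>c \<notin> B2\<close> cd sub B2I by blast
      then obtain a where a: "a \<in> L" "E b a" using b unfolding B2_def by blast
      have "\<not> E a c" using \<open>c \<notin> B2\<close> a cd sub adj_sym unfolding B2_def by blast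
      moreover have "\<not> E u b" "\<not> E u c" "\<not> E u d"
        using \<open>b \<notin> B1\<close> \<open>c \<notin> B2\<close> b cd sub unfolding B1_def L_def by blast+
      moreover have "\<not> E a d" "\<not> E b d" using a b cd sub adj_sym unfolding B3_def by blast+
      moreover have "E u a" "E a b" "E b c" "E c d" using a b cd adj_sym unfolding L_def by blast+
      moreover have "a \<noteq> u" "b \<noteq> u" "c \<noteq> u" "d \<noteq> u" "a \<in> X" "b \<in> X" "c \<in> X" "d \<in> X"
        using calculation adj_irrefl a b cd sub unfolding L_def by blast+
      ultimately show False using P6[of p u a b c d] privD[OF p] by blast
    qed
    have B2X: "B2 = X"
    proof (rule ccontr)
      assume "B2 \<noteq> X"
      then obtain c where c: "c \<in> X" "c \<notin> B2" using sub \<open>B3 = X\<close> by blast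
      \<comment> \<open>A vertex at distance three is no cut vertex, as the ball \<open>B2\<close>
        is connected and everything else is attached to it; so \<open>no_P4\<close> applies to
        \<open>u a b c\<close>.\<close>
      have cc: "conn (X - {c})"
        by (rule conn_hub[OF c2]) (use sub c \<open>B3 = X\<close> in \<open>auto simp: B3_def\<close>)
      obtain b where b: "b \<in> B2" "E c b" using c \<open>B3 = X\<close> unfolding B3_def by blast
      then have "b \<notin> B1" using c B2I by blast
      then obtain a where a: "a \<in> L" "E b a" using b unfolding B2_def by blast
      have "a \<in> X" "E u a" "b \<in> X" using a b sub \<open>B3 = X\<close> unfolding L_def by blast+
      moreover have "E a b" "E b c" using a b adj_sym by blast+
      moreover have "\<not> E u b" using \<open>b \<notin> B1\<close> \<open>b \<in> X\<close> unfolding B1_def L_def by blast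
      moreover have "\<not> E u c" using c sub unfolding B1_def L_def by blast
      moreover have "\<not> E a c" using c a B2I[of a c] sub adj_sym by blast
      ultimately show False using no_P4[OF X no6 u _ _ c(1) cc, of a b] by blast
    qed
    define M where "M = X - B1"
    have M_L: "\<exists>l\<in>L. E y l" if "y \<in> M" for y
      using that B2X unfolding M_def B2_def by blast
    have M_noncut: "conn (X - {y})" if "y \<in> M" for y
    proof (rule conn_hub[OF c1])
      show "B1 \<subseteq> X - {y}" using that sub unfolding M_def by blast
      fix x assume "x \<in> X - {y}" "x \<notin> B1"
      then have "x \<in> M" unfolding M_def by blast
      then show "\<exists>l\<in>B1. E x l" using M_L sub by blast
    qed (use sub in blast)
    have M_u: "\<not> E u y" "y \<noteq> u" if "y \<in> M" for y
      using that unfolding M_def B1_def L_def by blast+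
    have B1_clique: "clique B1"
      unfolding clique_def
    proof (intro conjI ballI impI)
      show "B1 \<subseteq> V" using sub XV by blast
      have uL: "E u x \<and> E x u" if "x \<in> L" for x using that adj_sym unfolding L_def by blast
      fix x y assume "x \<in> B1" "y \<in> B1" "x \<noteq> y"
      then show "E x y" using L_clique[of x y] uL unfolding B1_def by auto
    qed
    have own: "\<exists>y'\<in>M. E t y' \<and> (\<forall>l\<in>L. E l y' \<longrightarrow> l = t)" if t: "t \<in> L" "y \<in> M" "E t y" for t y
    proof (rule ccontr)
      assume no: "\<not> ?thesis"
      have "t \<noteq> u" using t adj_irrefl unfolding L_def by blast
      \<comment> \<open>If all neighbours of \<open>t\<close> in \<open>M\<close> could reach
        \<open>L\<close> otherwise, \<open>t\<close> would not be a cut vertex, and its neighbours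
        \<open>u\<close> and \<open>y\<close> would be adjacent by
        \<open>nbrs_clique\<close>.\<close>
      have "conn (X - {t})"
      proof (rule conn_hub[OF c1'[OF \<open>t \<noteq> u\<close>]])
        fix x assume x: "x \<in> X - {t}" "x \<notin> B1 - {t}"
        then have "x \<in> M" unfolding M_def by blast
        then obtain l where "l \<in> L" "E x l" "l \<noteq> t" using no M_L[of x] adj_sym by blast
        then show "\<exists>y\<in>B1 - {t}. E x y" unfolding B1_def by blast
      qed (use sub \<open>t \<noteq> u\<close> in auto)
      then have "E u y"
        using nbrs_clique[OF X, of t u y] t u M_u adj_sym unfolding L_def M_def by blast
      then show False using M_u t by blast
    qed
    show ?thesis
    proof (cases "M = {}")
      case True
      then have "X = B1" using sub unfolding M_def by blast
      then show ?thesis using B1_clique by blast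
    next
      case False
      then obtain y0 s where s: "y0 \<in> M" "s \<in> L" "E s y0" using M_L adj_sym by blast
      \<comment> \<open>Two vertices of \<open>L\<close> with neighbours in \<open>M\<close> have
        private ones \<open>y1\<close>, \<open>y2\<close> by \<open>own\<close>, and
        \<open>y1 s t y2\<close> contradicts \<open>no_P4\<close>.\<close>
      have uniq: "t = s" if t: "t \<in> L" "y \<in> M" "E t y" for t y
      proof (rule ccontr)
        assume "t \<noteq> s"
        obtain y1 where y1: "y1 \<in> M" "E s y1" "\<And>l. l \<in> L \<Longrightarrow> E l y1 \<Longrightarrow> l = s"
          using own s by metis
        obtain y2 where y2: "y2 \<in> M" "E t y2" "\<And>l. l \<in> L \<Longrightarrow> E l y2 \<Longrightarrow> l = t"
          using own t by metis
        have inX: "y1 \<in> X" "y2 \<in> X" "s \<in> X" "t \<in> X" using y1 y2 s t unfolding M_def L_def by blast+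
        have n: "\<not> E s y2" "\<not> E t y1" "E s t" using y1 y2 s t \<open>t \<noteq> s\<close> L_clique by blast+
        have "\<not> E y1 y2"
        proof
          assume "E y1 y2"
          moreover have "s \<noteq> y2" using s y2 unfolding M_def B1_def by blast
          ultimately have "E s y2"
            using nbrs_clique[OF X inX(1) M_noncut[OF y1(1)] inX(3) inX(2)] y1 adj_sym by blast
          then show False using n by blast
        qed
        then show False
          using no_P4[OF X no6 inX(1) M_noncut[OF y1(1)] inX(3,4,2) M_noncut[OF y2(1)]] n y1 y2 adj_sym
          by blast
      qed
      have M_s: "E s y" if "y \<in> M" for y using uniq M_L[OF that] that adj_sym by blast
      have "clique M"
        unfolding clique_def
      proof (intro conjI ballI impI)
        show "M \<subseteq> V" using XV unfolding M_def by blast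
        fix x y assume xy: "x \<in> M" "y \<in> M" "x \<noteq> y"
        show "E x y"
          using claw[of s u x y] M_s[OF xy(1)] M_s[OF xy(2)] M_u xy s adj_sym unfolding L_def by blast
      qed
      moreover have "\<not> E x y" if "x \<in> B1 - {s}" "y \<in> M" for x y
        using uniq that M_u unfolding B1_def by blast
      moreover have "E s x" if "x \<in> B1" "x \<noteq> s" for x
        using clique_adj[OF B1_clique] that s sub by blast
      moreover have "s \<noteq> u" using s adj_irrefl unfolding L_def by blast
      ultimately have "two_star X s (B1 - {s}) M"
        unfolding two_star_def using B1_clique M_s s u sub \<open>M \<noteq> {}\<close> \<open>B3 = X\<close>
        unfolding M_def clique_def by auto
      then show ?thesis by blast
    qed
  qed
qed

section \<open>Private neighbours for two cliques glued at a vertex\<close>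

text \<open>The path \<open>p' a' a pa pb b\<close> is not induced, so \<open>p'\<close> sees
  \<open>pa\<close> or \<open>pb\<close>; claw-freeness at the one it sees gives the other.\<close>

lemma two_star_adjacent_privates:
  assumes st: "two_star X s Q R" and a: "a \<in> Q" "a' \<in> Q" "a \<noteq> a'" and b: "b \<in> R"
    and pa: "pa \<in> priv X a" and pb: "pb \<in> priv X b" and p': "p' \<in> priv X a'" and adj: "E pa pb"
  shows "E p' pa \<and> E p' pb"
proof -
  note s = st[unfolded two_star_def]
  have "E a a'" using s a clique_adj[of Q a a'] by blast
  then have e: "E a a'" "E p' a'" "E pb b" "E a pa" "E pa a" "E b pb"
    using privD(3,4)[OF pa] privD(3,4)[OF pb] privD(3,4)[OF p'] by simp_all
  have X: "a \<in> X" "a' \<in> X" "b \<in> X" "a \<noteq> b" "a' \<noteq> b" using s a b by blast+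
  have n: "\<not> E a b" "\<not> E a' b" "\<not> E b a" "\<not> E b a'" using s a b adj_sym by blast+
  have n': "\<not> E pa a'" "\<not> E pa b" "\<not> E pb a" "\<not> E pb a'" "\<not> E p' a" "\<not> E p' b"
    using privD(5)[OF pa] privD(5)[OF pb] privD(5)[OF p'] X a by blast+
  have "E p' pa \<or> E p' pb"
    using P6[of p' a' a pa pb b] e n n' adj by (auto simp: adj_commute)
  moreover have "E p' pb" if "E p' pa"
    using claw_nonadj[of pa a p' pb] that e n' adj X privD[OF p'] privD[OF pb] adj_sym by blast
  moreover have "E p' pa" if "E p' pb"
    using claw_nonadj[of pb b p' pa] that e n' adj X privD[OF p'] privD[OF pa] adj_sym by blast
  ultimately show ?thesis by blast
qed

text \<open>Otherwise \<open>{s, b, pb}\<close>, whose vertices are all equal or adjacent to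
  \<open>b\<close>, dominates and yields a two-clique cover. A vertex \<open>w\<close> that it
  misses sees some \<open>a1\<close> in \<open>Q\<close> or some \<open>c\<close> in
  \<open>R\<close>. In the first case \<open>w a1 s b pb p2\<close>, with a suitable private
  neighbour \<open>p2\<close>, induces a path or a 6-cycle; in the second,
  \<open>w c s a pa pb\<close> is an induced path unless there is a claw at
  \<open>pa\<close>.\<close>

lemma two_star_privates_nonadjacent_across:
  assumes no6: "\<And>a b c d e f. \<not> C6 a b c d e f" and no2: "\<not> two_clique_cover"
    and X: "min_cds X" and st: "two_star X s Q R"
    and a: "a \<in> Q" "a' \<in> Q" "a \<noteq> a'" and b: "b \<in> R"
    and priv: "\<And>c. c \<in> Q \<union> R \<Longrightarrow> priv X c \<noteq> {}"
    and pa: "pa \<in> priv X a" and pb: "pb \<in> priv X b"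
  shows "\<not> E pa pb"
proof
  assume adj: "E pa pb"
  note s = st[unfolded two_star_def]
  have XV: "X \<subseteq> V" using min_cds_V[OF X] .
  have inX: "a \<in> X" "a' \<in> X" "b \<in> X" "s \<in> X" "a \<noteq> b" "a' \<noteq> b" "s \<noteq> b" using s a b by blast+
  have "dominating {s, b, pb}"
    unfolding dominating_def
  proof (intro conjI ballI)
    show "{s, b, pb} \<subseteq> V" using inX XV privD[OF pb] by blast
    fix w assume w: "w \<in> V"
    show "covers {s, b, pb} w"
    proof (rule ccontr)
      assume "\<not> covers {s, b, pb} w"
      then have nw: "\<not> E w s" "\<not> E w b" "\<not> E w pb" "w \<noteq> s" "w \<noteq> b" "w \<noteq> pb"
        unfolding covers_def by blast+
      then have "w \<notin> X" using s adj_sym by blast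
      then obtain c where c: "c \<in> X" "E w c"
        using X w unfolding min_cds_def dominating_def covers_def by blast
      have Q: False if cQ: "a1 \<in> Q" "E w a1" for a1
      proof -
        obtain a2 where a2: "a2 \<in> Q" "a2 \<noteq> a1" using a by metis
        obtain p2 where p2: "p2 \<in> priv X a2" "E p2 pb"
        proof (cases "a2 = a")
          case True
          then show ?thesis using that pa adj by blast
        next
          case False
          obtain p2 where "p2 \<in> priv X a2" using priv a2 by blast
          then show ?thesis
            using that two_star_adjacent_privates[OF st a(1) a2(1) _ b pa pb _ adj] False by blast
        qed
        have e: "E w a1" "E a1 s" "E s b" "E b pb" "E pb p2"
          using cQ s b p2 privD[OF pb] adj_sym by blast+
        have "a1 \<in> X" "a1 \<noteq> b" "a2 \<noteq> b" "a2 \<noteq> s" "\<not> E a1 b" using s cQ b a2(1) by blast+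
        then have n: "\<not> E a1 b" "\<not> E a1 pb" "\<not> E s pb" "\<not> E a1 p2" "\<not> E s p2" "\<not> E b p2"
          using \<open>a2 \<noteq> a1\<close> \<open>a2 \<noteq> b\<close> \<open>a2 \<noteq> s\<close> inX privD(5)[OF pb, of a1] privD(5)[OF pb, of s]
            privD(5)[OF p2(1), of a1] privD(5)[OF p2(1), of s] privD(5)[OF p2(1), of b]
          by auto
        show False
        proof (cases "E w p2")
          case True
          then have "C6 w a1 s b pb p2" unfolding C6_def using e n nw by (simp add: adj_commute)
          then show False using no6 by blast
        next
          case False
          then show False using P6[of w a1 s b pb p2] e n nw by blast
        qed
      qed
      have "c \<in> R" using Q c nw s by blast
      have nc: "\<not> E w a" using Q a by blast
      have "c \<noteq> b" using c nw by blast
      have e: "E w c" "E c s" "E s a" "E a pa" "E pa pb"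
        using c s a \<open>c \<in> R\<close> privD[OF pa] adj adj_sym by blast+
      have "a \<noteq> c" "s \<noteq> a" using s a \<open>c \<in> R\<close> by blast+
      have n: "\<not> E c a" "\<not> E c pa" "\<not> E s pa" "\<not> E c pb" "\<not> E s pb" "\<not> E a pb" "\<not> E pb a"
      proof -
        have "\<not> E a c" using s a \<open>c \<in> R\<close> by blast
        then show "\<not> E c a" using adj_sym by blast
      qed (use privD(5)[OF pa, of c] privD(5)[OF pa, of s] privD(5)[OF pb, of c] privD(5)[OF pb, of s]
        privD(5)[OF pb, of a] \<open>c \<noteq> b\<close> \<open>a \<noteq> c\<close> \<open>s \<noteq> a\<close> c inX in auto)
      have "w \<noteq> a" using c n adj_sym by blast
      show False
      proof (cases "E w pa")
        case True
        then show False
          using claw_nonadj[of pa a w pb] e n nc nw \<open>w \<noteq> a\<close> privD[OF pb] inX adj_sym by blast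
      next
        case False
        then show False using P6[of w c s a pa pb] e n nw nc by blast
      qed
    qed
  qed
  moreover have "card {s, b, pb} \<le> 3" by (simp add: card_insert_if)
  moreover have "E b x" if "x \<in> {s, b, pb}" "x \<noteq> b" for x
    using that s b privD[OF pb] adj_sym by blast
  ultimately show False using two_clique_cover_if_small_hub[of "{s, b, pb}" b] no2 by blast
qed

text \<open>Claw-freeness at \<open>x\<close> excludes every further neighbour that sees neither
  \<open>pa\<close> nor \<open>pb\<close>, such as \<open>s\<close>, \<open>a'\<close>,
  \<open>p'\<close>. Each remaining claim follows from a path beginning with \<open>p' a' a\<close>
  that must not be induced; a second vertex \<open>b'\<close> of \<open>R\<close> would end the path
  \<open>p' a' a x b b'\<close>.\<close>

lemma two_star_touch:
  assumes st: "two_star X s Q R" and a: "a \<in> Q" "a' \<in> Q" "a \<noteq> a'" and b: "b \<in> R"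
    and pa: "pa \<in> priv X a" and pb: "pb \<in> priv X b" and p': "p' \<in> priv X a'"
    and n0: "\<not> E pa pb" "\<not> E pa p'" "\<not> E pb p'"
    and x: "E x pa" "E x pb"
  shows "E x a \<and> E x b \<and> \<not> E x s \<and> \<not> E x a' \<and> \<not> E x p' \<and> R = {b}"
proof -
  note s = st[unfolded two_star_def]
  have X: "a \<in> X" "a' \<in> X" "b \<in> X" "a \<noteq> b" "a' \<noteq> b" "s \<in> X" "s \<noteq> a" "s \<noteq> b" "s \<noteq> a'" using s a b by blast+
  have np: "pa \<noteq> pb" "pa \<noteq> p'" "pb \<noteq> p'" "pa \<notin> X" "pb \<notin> X" "p' \<notin> X"
    using privD[OF pa] privD[OF pb] privD[OF p'] X a by blast+
  have n: "\<not> E a b" "\<not> E a' b" using s a b adj_sym by blast+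
  have n': "\<not> E pa a'" "\<not> E pa b" "\<not> E pa s" "\<not> E pb a" "\<not> E pb a'" "\<not> E pb s" "\<not> E p' a" "\<not> E p' b" "\<not> E p' s"
    using privD(5)[OF pa] privD(5)[OF pb] privD(5)[OF p'] X a by blast+
  have "E a a'" using s a clique_adj[of Q a a'] by blast
  then have e: "E a a'" "E p' a'" "E pb b" "E a pa" "E pa a" "E b pb"
    using privD(3,4)[OF pa] privD(3,4)[OF pb] privD(3,4)[OF p'] by simp_all
  have nx: "\<not> E x q" if "\<not> E pa q" "\<not> E pb q" "q \<noteq> pa" "q \<noteq> pb" for q
    using claw_nonadj[of x pa pb q] x that n0 np by blast
  have xs: "\<not> E x s" and xa': "\<not> E x a'" and xp': "\<not> E x p'"
    using nx n' n0 np X by auto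
  have xa: "E x a"
    by (rule ccontr) (use P6[of p' a' a pa x pb] e n n' n0 x xa' xp' in \<open>auto simp: adj_commute\<close>)
  have xb: "E x b"
    by (rule ccontr) (use P6[of p' a' a x pb b] e n n' n0 x xa xa' xp' in \<open>auto simp: adj_commute\<close>)
  have "b' = b" if b': "b' \<in> R" for b'
  proof (rule ccontr)
    assume "b' \<noteq> b"
    have "b' \<in> X" "a \<noteq> b'" "a' \<noteq> b'" using s b' a by blast+
    then have m: "\<not> E pa b'" "\<not> E pb b'" "\<not> E p' b'" "b' \<noteq> pa" "b' \<noteq> pb"
      using privD(5)[OF pa, of b'] privD(5)[OF pb, of b'] privD(5)[OF p', of b'] \<open>b' \<noteq> b\<close> np by auto
    have m': "\<not> E a b'" "\<not> E a' b'" "E b b'"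
      using s a b b' \<open>b' \<noteq> b\<close> clique_adj[of R b b'] by auto
    have "\<not> E x b'" using nx m by blast
    then show False
      using P6[of p' a' a x b b'] e n n' m m' xa xb xa' xp' by (auto simp: adj_commute)
  qed
  then show ?thesis using xs xa' xp' xa xb b by blast
qed

text \<open>By claw-freeness \<open>x\<close> sees none of \<open>pb\<close>, \<open>b\<close>,
  \<open>s\<close>. Then \<open>pb b s a x p'\<close> or \<open>x pa a s b pb\<close> is an induced
  path, according to whether \<open>x\<close> sees \<open>a\<close>.\<close>

lemma two_star_no_touch_same_side:
  assumes st: "two_star X s Q R" and a: "a \<in> Q" "a' \<in> Q" "a \<noteq> a'" and b: "b \<in> R"
    and pa: "pa \<in> priv X a" and pb: "pb \<in> priv X b" and p': "p' \<in> priv X a'"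
    and n0: "\<not> E pa pb" "\<not> E pa p'" "\<not> E pb p'"
    and x: "E x pa" "E x p'"
  shows False
proof -
  note s = st[unfolded two_star_def]
  have X: "a \<in> X" "a' \<in> X" "b \<in> X" "a \<noteq> b" "a' \<noteq> b" "s \<in> X" "s \<noteq> a" "s \<noteq> b" "s \<noteq> a'" using s a b by blast+
  have np: "pa \<noteq> pb" "pa \<noteq> p'" "pb \<noteq> p'" "pa \<notin> X" "pb \<notin> X" "p' \<notin> X"
    using privD[OF pa] privD[OF pb] privD[OF p'] X a by blast+
  have n: "\<not> E a b" "\<not> E a' b" using s a b adj_sym by blast+
  have n': "\<not> E pa a'" "\<not> E pa b" "\<not> E pa s" "\<not> E pb a" "\<not> E pb a'" "\<not> E pb s" "\<not> E p' a" "\<not> E p' b" "\<not> E p' s"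
    using privD(5)[OF pa] privD(5)[OF pb] privD(5)[OF p'] X a by blast+
  have e: "E pa a" "E a pa" "E p' a'" "E a' p'" "E pb b" "E b pb" "E a s" "E s a" "E a' s" "E s a'" "E s b" "E b s"
  proof -
    have "E s a" "E s a'" "E s b" using s a b by blast+
    then show "E pa a" "E a pa" "E p' a'" "E a' p'" "E pb b" "E b pb" "E a s" "E s a" "E a' s" "E s a'" "E s b" "E b s"
      using privD(3,4)[OF pa] privD(3,4)[OF pb] privD(3,4)[OF p'] adj_commute[of s] by simp_all
  qed
  have nx: "\<not> E x q" if "\<not> E pa q" "\<not> E p' q" "q \<noteq> pa" "q \<noteq> p'" for q
    using claw_nonadj[of x pa p' q] x that n0 np by blast
  have m: "\<not> E x pb" "\<not> E x b" "\<not> E x s"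
    using nx[of pb] nx[of b] nx[of s] n' n0 np X adj_commute[of p' pb] by metis+
  consider "E x a" | "\<not> E x a" by blast
  then show False
  proof cases
    case 1
    then show False using P6[of pb b s a x p'] e n n' n0 x m by (auto simp: adj_commute)
  next
    case 2
    then show False using P6[of x pa a s b pb] e n n' n0 x m by (auto simp: adj_commute)
  qed
qed

lemma two_star_noncut:
  assumes "two_star X s Q R" "c \<in> Q \<union> R"
  shows "conn (X - {c})"
proof (rule conn_hub[OF conn_singleton[of s]])
  show "{s} \<subseteq> X - {c}" using assms unfolding two_star_def by blast
  fix x assume "x \<in> X - {c}" "x \<notin> {s}"
  then have "E s x" using assms unfolding two_star_def by blast
  then show "\<exists>y\<in>{s}. E x y" using adj_sym by blast
qed simp

lemma priv_disjoint:
  assumes "p \<in> priv X c" "q \<in> priv X d" "c \<in> X" "c \<noteq> d"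
  shows "p \<noteq> q"
  using privD(4)[OF assms(1)] privD(5)[OF assms(2,3)] assms(4) by blast

text \<open>Otherwise \<open>pb b s a pa p'\<close> would be an induced path.\<close>

lemma two_star_privates_nonadjacent_same_side:
  assumes st: "two_star X s Q R" and a: "a \<in> Q" "a' \<in> Q" "a \<noteq> a'" and b: "b \<in> R"
    and pa: "pa \<in> priv X a" and pb: "pb \<in> priv X b" and p': "p' \<in> priv X a'"
    and n0: "\<not> E pa pb" "\<not> E pb p'"
  shows "\<not> E pa p'"
proof
  assume adj: "E pa p'"
  note s = st[unfolded two_star_def]
  have X: "a \<in> X" "a' \<in> X" "b \<in> X" "a \<noteq> b" "a' \<noteq> b" "s \<in> X" "s \<noteq> a" "s \<noteq> b" "s \<noteq> a'" using s a b by blast+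
  have ab: "\<not> E a b" using s a b by blast
  have sa: "E s a" "E s b" using s a b by blast+
  show False
    using P6[of pb b s a pa p'] n0 ab sa adj adj_commute[of b s] adj_commute[of b a] adj_commute[of pb pa]
      privD(4)[OF pb] privD(3)[OF pa]
      privD(5)[OF pb X(1)] privD(5)[OF pb X(6)]
      privD(5)[OF pa X(3)] privD(5)[OF pa X(6)]
      privD(5)[OF p' X(1)] privD(5)[OF p' X(3)] privD(5)[OF p' X(6)] X a(3)
    by auto
qed

text \<open>The gluing vertex is dropped from the dominating set. A vertex touching two cells
  touches the cell of some \<open>a \<in> Q\<close> and that of the only vertex \<open>b\<close> of
  \<open>R\<close>, and it can replace both \<open>a\<close> and \<open>b\<close>.\<close>

lemma anticomplete_cells_if_two_star_left:
  assumes no6: "\<And>a b c d e f. \<not> C6 a b c d e f" and no2: "\<not> two_clique_cover"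
    and X: "min_cds X" and st: "two_star X s Q R"
    and two: "a0 \<in> Q" "a1 \<in> Q" "a0 \<noteq> a1"
  shows "anticomplete_cells (Q \<union> R) (priv X)"
proof -
  note s = st[unfolded two_star_def]
  note st' = two_star_commute[OF st]
  have fX: "finite X" and XV: "X \<subseteq> V" using min_cds_finite[OF X] min_cds_V[OF X] by blast+
  obtain b0 where b0: "b0 \<in> R" using s by blast
  have sub: "Q \<union> R \<subseteq> X" "s \<in> X" using s by blast+
  have priv: "priv X c \<noteq> {}" if "c \<in> Q \<union> R" for c
    by (rule priv_ne[OF X _ two_star_noncut[OF st that]]) (use that s in blast)+
  have other: "\<exists>a'\<in>Q. a' \<noteq> a" for a using two by metis
  have QR: "\<not> E p q \<and> \<not> E q p" if "a \<in> Q" "b \<in> R" "p \<in> priv X a" "q \<in> priv X b" for a b p q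
  proof -
    obtain a' where "a' \<in> Q" "a \<noteq> a'" using other by metis
    then have "\<not> E p q"
      using two_star_privates_nonadjacent_across[OF no6 no2 X st that(1) _ _ that(2) priv that(3,4)] by blast
    then show ?thesis using adj_sym by blast
  qed
  have PP: "\<not> E p q" if cd: "c \<in> Q \<union> R" "d \<in> Q \<union> R" "c \<noteq> d" and pq: "p \<in> priv X c" "q \<in> priv X d" for c d p q
  proof -
    consider "c \<in> Q" "d \<in> R" | "c \<in> R" "d \<in> Q" | "c \<in> Q" "d \<in> Q" | "c \<in> R" "d \<in> R" using cd by blast
    then show ?thesis
    proof cases
      case 1
      then show ?thesis using QR pq by blast
    next
      case 2
      then show ?thesis using QR pq by blast
    next
      case 3
      obtain r where r: "r \<in> priv X b0" using priv b0 by blast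
      have "\<not> E p r" "\<not> E r q" using QR 3 b0 pq r by blast+
      then show ?thesis
        using two_star_privates_nonadjacent_same_side[OF st 3 cd(3) b0 pq(1) r pq(2)] by blast
    next
      case 4
      obtain r where r: "r \<in> priv X a0" using priv two by blast
      have "\<not> E p r" "\<not> E r q" using QR 4 two pq r by blast+
      then show ?thesis
        using two_star_privates_nonadjacent_same_side[OF st' 4 cd(3) two(1) pq(1) r pq(2)] by blast
    qed
  qed
  have anti: "\<not> touches p (priv X d)" if "c \<in> Q \<union> R" "d \<in> Q \<union> R" "c \<noteq> d" "p \<in> priv X c" for c d p
    using PP[OF that(1-3)] that priv_disjoint sub unfolding touches_def by blast
  have across: "R = {d} \<and> E x c \<and> E x d \<and> \<not> E x s \<and> (\<forall>a'\<in>Q. a' \<noteq> c \<longrightarrow> \<not> E x a' \<and> (\<forall>p'\<in>priv X a'. \<not> E x p'))"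
    if c: "c \<in> Q" "d \<in> R" and p: "p \<in> priv X c" "q \<in> priv X d" and x: "E x p" "E x q" for x c d p q
  proof -
    have *: "E x c \<and> E x d \<and> \<not> E x s \<and> \<not> E x a' \<and> \<not> E x p' \<and> R = {d}"
      if a': "a' \<in> Q" "c \<noteq> a'" "p' \<in> priv X a'" for a' p'
    proof (rule two_star_touch[OF st c(1) a'(1,2) c(2) p a'(3) _ _ _ x])
      show "\<not> E p q" "\<not> E q p'" using QR c p a' by blast+
      show "\<not> E p p'" using PP[of c a' p p'] c a' p by blast
    qed
    obtain a' where "a' \<in> Q" "c \<noteq> a'" using other by metis
    moreover obtain p' where "p' \<in> priv X a'" using priv \<open>a' \<in> Q\<close> by blast
    ultimately have "R = {d} \<and> E x c \<and> E x d \<and> \<not> E x s" using * by blast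
    moreover have "\<not> E x a' \<and> (\<forall>p'\<in>priv X a'. \<not> E x p')" if "a' \<in> Q" "a' \<noteq> c" for a'
      using *[OF that(1) that(2)[symmetric]] priv[of a'] that(1) by blast
    ultimately show ?thesis by blast
  qed
  \<comment> \<open>Pairs on one side are excluded by comparison with a private neighbour of a
    vertex on the opposite side.\<close>
  have touch: "\<exists>a b. a \<in> Q \<and> R = {b} \<and> {c, d} = {a, b} \<and> E x a \<and> E x b \<and> \<not> E x s \<and>
      (\<forall>a'\<in>Q. a' \<noteq> a \<longrightarrow> \<not> E x a' \<and> (\<forall>p'\<in>priv X a'. \<not> E x p'))"
    if cd: "c \<in> Q \<union> R" "d \<in> Q \<union> R" "c \<noteq> d" and t: "touches x (priv X c)" "touches x (priv X d)" for x c d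
  proof -
    have "x \<notin> priv X c" "x \<notin> priv X d" using anti cd t by blast+
    then obtain p q where p: "p \<in> priv X c" "q \<in> priv X d" and x: "E x p" "E x q"
      using t unfolding touches_def by blast
    consider "c \<in> Q" "d \<in> R" | "c \<in> R" "d \<in> Q" | "c \<in> Q" "d \<in> Q" | "c \<in> R" "d \<in> R" using cd by blast
    then show ?thesis
    proof cases
      case 1
      then show ?thesis using across[OF 1 p x] by (intro exI[of _ c] exI[of _ d]) simp
    next
      case 2
      then show ?thesis using across[OF 2(2,1) p(2,1) x(2,1)]
        by (intro exI[of _ d] exI[of _ c]) auto
    next
      case 3
      obtain r where r: "r \<in> priv X b0" using priv b0 by blast
      have "\<not> E p r" "\<not> E r q" "\<not> E p q" using QR[OF 3(1) b0 p(1) r] QR[OF 3(2) b0 p(2) r] PP[OF cd p] by blast+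
      then show ?thesis using two_star_no_touch_same_side[OF st 3 cd(3) b0 p(1) r p(2) _ _ _ x] by blast
    next
      case 4
      obtain r where r: "r \<in> priv X a0" using priv two by blast
      have "\<not> E p r" "\<not> E r q" "\<not> E p q" using QR[OF two(1) 4(1) r p(1)] QR[OF two(1) 4(2) r p(2)] PP[OF cd p] by blast+
      then show ?thesis using two_star_no_touch_same_side[OF st' 4 cd(3) two(1) p(1) r p(2) _ _ _ x] by blast
    qed
  qed
  have nbr: "\<exists>c\<in>X. E w c" if "w \<in> V" "w \<notin> X" for w
    using X that unfolding min_cds_def dominating_def covers_def by blast
  have sE: "E s c" "E c s" if "c \<in> Q \<union> R" for c using s that adj_sym by blast+
  have dom: "dominating (Q \<union> R)"
    unfolding dominating_def
  proof (intro conjI ballI)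
    show "Q \<union> R \<subseteq> V" using sub XV by blast
    fix w assume w: "w \<in> V"
    show "covers (Q \<union> R) w"
    proof (cases "w \<in> X")
      case True
      then show ?thesis using s sE b0 unfolding covers_def by blast
    next
      case False
      then obtain c where c: "c \<in> X" "E w c" using nbr w by blast
      show ?thesis
      proof (cases "c = s")
        case True
        \<comment> \<open>A vertex that sees \<open>s\<close> also sees \<open>a0\<close> or
          \<open>b0\<close>, since these are nonadjacent neighbours of \<open>s\<close>.\<close>
        have "w \<noteq> a0" "w \<noteq> b0" "a0 \<noteq> b0" "\<not> E a0 b0" using False sub two b0 s by blast+
        then have "E w a0 \<or> E w b0"
          using claw_nonadj[of s w a0 b0] c True adj_sym[of w s] adj_commute[of w] sE(1) two b0 by blast
        then show ?thesis using two b0 unfolding covers_def by blast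
      next
        case False
        then show ?thesis using c s unfolding covers_def by blast
      qed
    qed
  qed
  have small: "\<exists>S. dominating S \<and> card S < card (Q \<union> R)"
    if t: "c \<in> Q \<union> R" "d \<in> Q \<union> R" "c \<noteq> d" "touches x (priv X c)" "touches x (priv X d)" for x c d
  proof -
    obtain a b where ab: "a \<in> Q" "R = {b}" "E x a" "E x b" "\<not> E x s"
      and xQ: "\<And>a'. a' \<in> Q \<Longrightarrow> a' \<noteq> a \<Longrightarrow> \<not> E x a'" "\<And>a' p'. a' \<in> Q \<Longrightarrow> a' \<noteq> a \<Longrightarrow> p' \<in> priv X a' \<Longrightarrow> \<not> E x p'"
      using touch[OF t] by blast
    obtain a' where a': "a' \<in> Q" "a' \<noteq> a" using other by blast
    obtain p' where p': "p' \<in> priv X a'" using priv a' by blast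
    let ?S = "insert x (Q - {a})"
    have aa: "E a a'" "E a' a" using s ab a' clique_adj[of Q] by auto
    have ds: "b \<in> R" "b \<noteq> s" "a \<noteq> s" "a' \<noteq> s" "a \<noteq> b" "a' \<noteq> b" "\<not> E a' b" "\<not> E a b" using ab s a' by blast+
    have "dominating ?S"
      unfolding dominating_def
    proof (intro conjI ballI)
      show "?S \<subseteq> V" using ab adj_V sub XV by blast
      fix w assume w: "w \<in> V"
      show "covers ?S w"
      proof (rule ccontr)
        assume "\<not> covers ?S w"
        then have nw: "w \<noteq> x" "\<not> E w x" "\<And>c. c \<in> Q \<Longrightarrow> c \<noteq> a \<Longrightarrow> \<not> E w c \<and> w \<noteq> c"
          unfolding covers_def by blast+
        \<comment> \<open>A missed vertex \<open>w\<close> lies outside \<open>X\<close>. Claws at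
          \<open>a\<close>, \<open>b\<close> and \<open>s\<close> force it to miss \<open>a\<close>
          and to see both \<open>b\<close> and \<open>s\<close>; then \<open>w b x a a' p'\<close>
          induces a path or a 6-cycle.\<close>
        have wX: "w \<notin> X"
        proof
          assume "w \<in> X"
          then consider "w = s" | "w = a" | "w = b" | "w \<in> Q" "w \<noteq> a" using s ab(2) by blast
          then show False
            by cases (use nw a' sE[of a'] ab adj_sym in blast)+
        qed
        have xw: "\<not> E x w" using nw adj_sym by blast
        have nwa: "\<not> E w a"
        proof
          assume "E w a"
          moreover have "x \<noteq> a'" using ab(5) sE(2)[of a'] a' by blast
          ultimately show False
            using claw_nonadj[of a w x a'] nw(1,2) nw(3)[OF a'] xQ(1)[OF a'] aa ab(3)
              adj_commute[of a w] adj_commute[of a x] by metis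
        qed
        have "E w b \<or> E w s"
        proof -
          obtain c where "c \<in> X" "E w c" using nbr w wX by blast
          then show ?thesis using s ab(2) nw(3) nwa by blast
        qed
        moreover have "x \<noteq> s" using xQ(1)[OF a'] sE(1)[of a'] a' by blast
        moreover from this have "E w s" if "E w b"
          using claw_nonadj[of b w x s] that nw(1,2) ab(4,5) sE[of b] ds wX sub(2)
            adj_commute[of b w] adj_commute[of b x] adj_commute[of s x] by blast
        moreover have "E w b" if "E w s"
          using claw_nonadj[of s w a' b] that nw(3)[OF a'] sE[of b] sE[of a'] ds a' wX sub
            adj_commute[of s w] by blast
        ultimately have ws: "E w s" "E w b" by blast+
        have e: "E w b" "E b x" "E x a" "E a a'" "E a' p'"
          using ws ab aa privD(3)[OF p'] adj_sym by blast+
        have n: "\<not> E w x" "\<not> E w a" "\<not> E w a'" "\<not> E b a" "\<not> E b a'" "\<not> E b p'" "\<not> E x a'" "\<not> E x p'" "\<not> E a p'"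
          using nw(2) nwa nw(3)[OF a'] ds xQ(1)[OF a'] xQ(2)[OF a' p'] adj_commute[of b]
            privD(5)[OF p', of b] privD(5)[OF p', of a] sub ab(1) a' by auto
        show False
        proof (cases "E w p'")
          case True
          then have "C6 w b x a a' p'" unfolding C6_def using e n by (simp add: adj_commute[of p'])
          then show False using no6 by blast
        next
          case False
          then show False using P6[of w b x a a' p'] e n by blast
        qed
      qed
    qed
    moreover have "card ?S < card (Q \<union> R)"
    proof -
      have fQ: "finite Q" using fX sub finite_subset by blast
      have "card ?S \<le> Suc (card (Q - {a}))" using fQ by (simp add: card_insert_if)
      also have "\<dots> = card Q" by (rule card_Suc_Diff1[OF fQ ab(1)])
      also have "\<dots> < card (Q \<union> R)" using fQ s ab(2) by auto
      finally show ?thesis .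
    qed
    ultimately show ?thesis by blast
  qed
  have meet: "{a, b} \<inter> {c, d} \<noteq> {}"
    if t: "a \<in> Q \<union> R" "b \<in> Q \<union> R" "c \<in> Q \<union> R" "d \<in> Q \<union> R" "touches x (priv X a)" "touches x (priv X b)"
      "touches y (priv X c)" "touches y (priv X d)" "a \<noteq> b" "c \<noteq> d" for x y a b c d
  proof -
    \<comment> \<open>Both touched pairs contain the only vertex of \<open>R\<close>.\<close>
    obtain r where "R = {r}" "r \<in> {a, b}" using touch[OF t(1,2,9,5,6)] by auto
    moreover obtain r' where "R = {r'}" "r' \<in> {c, d}" using touch[OF t(3,4,10,7,8)] by auto
    ultimately show ?thesis by auto
  qed
  have pV: "priv X a \<subseteq> V" for a unfolding priv_def by blast
  show ?thesis
    unfolding anticomplete_cells_def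
    using dom priv pV anti small meet by (intro conjI ballI allI impI; meson)
qed

text \<open>With at most three vertices \<open>X\<close> would be a small hub around
  \<open>s\<close>. So one of the two sides has two vertices, and by symmetry it can be taken to be
  \<open>Q\<close>.\<close>

lemma anticomplete_cells_if_two_star:
  assumes no6: "\<And>a b c d e f. \<not> C6 a b c d e f" and no2: "\<not> two_clique_cover"
    and X: "min_cds X" and st: "two_star X s Q R"
  shows "\<exists>C P. anticomplete_cells C P"
proof -
  note s = st[unfolded two_star_def]
  have "\<not> card X \<le> 3"
    using two_clique_cover_if_small_hub[of X s] no2 X s unfolding min_cds_def by blast
  obtain a b where ab: "a \<in> Q" "b \<in> R" using s by blast
  have "\<not> X \<subseteq> {s, a, b}"
  proof
    assume "X \<subseteq> {s, a, b}"
    then have "card X \<le> card {s, a, b}" by (rule card_mono[rotated]) simp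
    also have "\<dots> \<le> 3" by (simp add: card_insert_if)
    finally show False using \<open>\<not> card X \<le> 3\<close> by simp
  qed
  then obtain c where "c \<in> Q \<union> R" "c \<noteq> a" "c \<noteq> b" using s by blast
  then consider "c \<in> Q" "c \<noteq> a" | "c \<in> R" "c \<noteq> b" by blast
  then show ?thesis
  proof cases
    case 1
    then show ?thesis using anticomplete_cells_if_two_star_left[OF no6 no2 X st ab(1)] by blast
  next
    case 2
    then show ?thesis
      using anticomplete_cells_if_two_star_left[OF no6 no2 X two_star_commute[OF st] ab(2)] by blast
  qed
qed

section \<open>Private neighbours when the minimum connected dominating set is a clique\<close>

text \<open>Claws at \<open>pa\<close> and \<open>pb\<close> show that \<open>pc\<close> sees both
  or neither of them. If neither, \<open>pc c a pa pb pb'\<close> induces a path or a 6-cycle; if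
  both, a claw at \<open>pc\<close> excludes \<open>pb'\<close>.\<close>

lemma clique_third_private:
  assumes no6: "\<And>a b c d e f. \<not> C6 a b c d e f"
    and X: "clique X" and abc: "a \<in> X" "b \<in> X" "c \<in> X" "a \<noteq> b" "c \<noteq> a" "c \<noteq> b"
    and pa: "pa \<in> priv X a" and pb: "pb \<in> priv X b" and pb': "pb' \<in> priv X b" and pc: "pc \<in> priv X c"
    and adj: "E pa pb" and nadj: "\<not> E pb' pa" and ne: "pb' \<noteq> pb"
  shows "E pc pa \<and> E pc pb \<and> \<not> E pc pb'"
proof -
  have e: "E a b" "E b c" "E c a" "E a c"
    using clique_adj[OF X] abc by blast+
  have ep: "E a pa" "E pa a" "E b pb" "E pb b" "E b pb'" "E pb' b" "E c pc" "E pc c"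
    using privD(3,4)[OF pa] privD(3,4)[OF pb] privD(3,4)[OF pb'] privD(3,4)[OF pc] by blast+
  have n: "\<not> E pa b" "\<not> E pa c" "\<not> E b pa" "\<not> E c pa" "\<not> E pb a" "\<not> E pb c" "\<not> E a pb" "\<not> E c pb"
    "\<not> E pb' a" "\<not> E pb' c" "\<not> E a pb'" "\<not> E c pb'" "\<not> E pc a" "\<not> E pc b" "\<not> E a pc" "\<not> E b pc"
    using privD(5)[OF pa, of b] privD(5)[OF pa, of c] privD(5)[OF pb, of a] privD(5)[OF pb, of c]
      privD(5)[OF pb', of a] privD(5)[OF pb', of c] privD(5)[OF pc, of a] privD(5)[OF pc, of b] abc
    by auto
  have d: "pa \<noteq> pb" "pa \<noteq> pb'" "pa \<noteq> pc" "pb \<noteq> pc" "pb' \<noteq> pc"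
    using ep n by blast+
  have pX: "pa \<notin> X" "pb \<notin> X" "pb' \<notin> X" "pc \<notin> X"
    using privD(2)[OF pa] privD(2)[OF pb] privD(2)[OF pb'] privD(2)[OF pc] by blast+
  have x: "a \<noteq> pb" "a \<noteq> pb'" "a \<noteq> pc" "b \<noteq> pa" "b \<noteq> pc" "c \<noteq> pa" "c \<noteq> pb'" using pX abc by blast+
  have "E pb pb'"
    using claw_nonadj[of b pb pb' a] e(1) ep n x ne adj_commute[of b a] by metis
  have 1: "E pc pa" if "E pc pb"
    using claw_nonadj[of pb b pa pc] ep n that adj d x adj_commute[of pa pb] adj_commute[of pb pc] adj_commute[of pa pc] by metis
  have 2: "E pc pb" if "E pc pa"
    using claw_nonadj[of pa a pb pc] ep n that adj d x adj_commute[of pb pc] adj_commute[of pa pc] by metis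
  show ?thesis
  proof (cases "E pc pa")
    case True
    moreover have "\<not> E pc pb'"
      using claw_nonadj[of pc c pa pb'] ep n True nadj d x adj_commute[of pb' pa] by metis
    ultimately show ?thesis using 2 by blast
  next
    case False
    then have "\<not> E pc pb" using 1 by blast
    show ?thesis
    proof (cases "E pc pb'")
      case True
      have "C6 a pa pb pb' pc c"
        unfolding C6_def using ep e n adj \<open>E pb pb'\<close> nadj True False \<open>\<not> E pc pb\<close>
          adj_commute[of pb' pc] adj_commute[of pb' pa] adj_commute[of pc pa] adj_commute[of pb pc]
        by auto
      then show ?thesis using no6 by blast
    next
      case c: False
      then show ?thesis
        using P6[of pc c a pa pb pb'] ep e n adj \<open>E pb pb'\<close> nadj False \<open>\<not> E pc pb\<close>
          adj_commute[of pb' pa] by metis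
    qed
  qed
qed

text \<open>\<open>clique_third_private\<close>, applied from both sides, shows that
  \<open>pc\<close> sees \<open>pa\<close> and \<open>pb\<close> but neither \<open>pa'\<close> nor
  \<open>pb'\<close>. Then \<open>pb' b c pc pa pa'\<close> is an induced path.\<close>

lemma clique_privates_one_sided:
  assumes no6: "\<And>a b c d e f. \<not> C6 a b c d e f"
    and X: "clique X" and abc: "a \<in> X" "b \<in> X" "c \<in> X" "a \<noteq> b" "c \<noteq> a" "c \<noteq> b"
    and pa: "pa \<in> priv X a" and pb: "pb \<in> priv X b" and pc: "pc \<in> priv X c"
    and pa': "pa' \<in> priv X a" and pb': "pb' \<in> priv X b"
    and adj: "E pa pb" and nadj: "\<not> E pb' pa" "\<not> E pa' pb"
  shows False
proof -
  have ne: "pb' \<noteq> pb" "pa' \<noteq> pa" using adj nadj adj_sym by blast+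
  have 1: "E pc pa \<and> E pc pb \<and> \<not> E pc pb'"
    by (rule clique_third_private[OF no6 X abc pa pb pb' pc adj nadj(1) ne(1)])
  have 2: "E pc pb \<and> E pc pa \<and> \<not> E pc pa'"
    by (rule clique_third_private[OF no6 X abc(2,1,3) _ abc(6,5) pb pa pa' pc adj_sym[OF adj] nadj(2) ne(2)])
      (use abc in blast)
  have e: "E a b" "E b c" "E c a" "E a c"
    using clique_adj[OF X] abc by blast+
  have "\<not> E pa' pb'"
  proof
    assume "E pa' pb'"
    then have "E pc pa'"
      using clique_third_private[OF no6 X abc pa' pb' pb pc] nadj(2) ne adj_commute by metis
    then show False using 2 by blast
  qed
  have "E pa pa'"
    using claw[of a pa pa' b] e(1) privD(3)[OF pa] privD(3)[OF pa'] ne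
      privD(5)[OF pa abc(2)] privD(5)[OF pa' abc(2)] privD(2)[OF pa] privD(2)[OF pa'] abc by metis
  then show False
    using P6[of pb' b c pc pa pa'] 1 2 e \<open>\<not> E pa' pb'\<close> nadj privD(4)[OF pb'] privD(3)[OF pc]
      privD(5)[OF pb' abc(3)] privD(5)[OF pc abc(2)] privD(5)[OF pa abc(2)] privD(5)[OF pa' abc(2)]
      privD(5)[OF pa abc(3)] privD(5)[OF pa' abc(3)] abc
      adj_commute[of pb' pc] adj_commute[of pb' pa'] by metis
qed

text \<open>If all private neighbours of \<open>b\<close> see \<open>pa\<close>, then \<open>b\<close> can be exchanged for \<open>pa\<close>.\<close>
lemma two_star_if_clique:
  assumes M: "min_cds X" and X: "clique X" and abc: "a \<in> X" "b \<in> X" "c \<in> X" "a \<noteq> b" "c \<noteq> a" "c \<noteq> b"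
    and pa: "pa \<in> priv X a" and all: "\<And>q. q \<in> priv X b \<Longrightarrow> E q pa"
  shows "\<exists>Y s Q R. min_cds Y \<and> two_star Y s Q R"
proof -
  let ?Y = "insert pa (X - {b})"
  have XV: "X \<subseteq> V" "finite X" using min_cds_V min_cds_finite M by blast+
  have e: "E a x" "E x a" if "x \<in> X" "x \<noteq> a" for x using clique_adj[OF X] that abc by blast+
  have pX: "pa \<notin> X" "pa \<in> V" using privD[OF pa] by blast+
  have "two_star ?Y a (X - {a, b}) {pa}"
    unfolding two_star_def
  proof (intro conjI ballI)
    show "?Y = insert a (X - {a, b} \<union> {pa})" using abc by blast
    show "X - {a, b} \<noteq> {}" using abc by blast
    show "clique (X - {a, b})" using X unfolding clique_def by blast
    show "clique {pa}" using pX unfolding clique_def by blast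
    fix x
    { assume "x \<in> X - {a, b} \<union> {pa}"
      then show "E a x" using e privD(3)[OF pa] by blast }
    fix y
    assume "x \<in> X - {a, b}" "y \<in> {pa}"
    then show "\<not> E x y" using privD(5)[OF pa] by blast
  qed (use pX abc in auto)
  moreover have "min_cds ?Y"
  proof -
    have "conn ?Y"
    proof (rule conn_hub[OF conn_singleton[of a]])
      fix x assume "x \<in> ?Y" "x \<notin> {a}"
      then show "\<exists>y\<in>{a}. E x y" using e privD(4)[OF pa] by blast
    qed (use abc in auto)
    moreover have "dominating ?Y"
      unfolding dominating_def
    proof (intro conjI ballI)
      show "?Y \<subseteq> V" using pX XV by blast
      fix w assume w: "w \<in> V"
      show "covers ?Y w"
      proof (rule ccontr)
        assume no: "\<not> covers ?Y w"
        have "w \<noteq> b" using no e[of b] abc unfolding covers_def by blast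
        then have "w \<notin> X" using no unfolding covers_def by blast
        then have "\<exists>y\<in>X. E w y" using M w unfolding min_cds_def dominating_def covers_def by blast
        moreover have "\<forall>y\<in>X. E w y \<longrightarrow> y = b" using no unfolding covers_def by blast
        \<comment> \<open>Only private neighbours of \<open>b\<close> depend on \<open>b\<close>,
          and these are covered by \<open>pa\<close>.\<close>
        ultimately have "w \<in> priv X b" using w \<open>w \<notin> X\<close> adj_sym unfolding priv_def by blast
        then show False using all no unfolding covers_def by blast
      qed
    qed
    moreover have "card ?Y = card X"
    proof -
      have "card ?Y = Suc (card (X - {b}))" using pX XV by simp
      then show ?thesis using card_Suc_Diff1[OF XV(2) abc(2)] by simp
    qed
    ultimately show ?thesis using M unfolding min_cds_def by simp
  qed
  ultimately show ?thesis by blast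
qed

text \<open>If private neighbours of two vertices were adjacent, one of the two vertices could be
  exchanged to give two glued cliques, a case already settled. So the private neighbourhoods of
  \<open>X\<close> itself serve as cells.\<close>

lemma anticomplete_cells_if_clique:
  assumes no6: "\<And>a b c d e f. \<not> C6 a b c d e f" and no2: "\<not> two_clique_cover"
    and M: "min_cds X" and X: "clique X"
  shows "\<exists>C P. anticomplete_cells C P"
proof (rule ccontr)
  assume no: "\<not> ?thesis"
  have XV: "X \<subseteq> V" "finite X" "dominating X" "X \<noteq> {}"
    using min_cds_V min_cds_finite M unfolding min_cds_def by blast+
  have third: "\<exists>c\<in>X. c \<noteq> a \<and> c \<noteq> b" for a b
  proof (rule ccontr)
    assume "\<not> ?thesis"
    then have "X \<subseteq> {a, b}" by blast
    then have "card X \<le> card {a, b}" by (rule card_mono[rotated]) simp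
    also have "\<dots> \<le> 3" by (simp add: card_insert_if)
    finally have "card X \<le> 3" .
    moreover obtain v where v: "v \<in> X" using XV by blast
    moreover have "E v x" if "x \<in> X" "x \<noteq> v" for x using clique_adj[OF X v that(1)] that by blast
    ultimately show False using two_clique_cover_if_small_hub[OF XV(3)] no2 by blast
  qed
  have e: "E x y" if "x \<in> X" "y \<in> X" "x \<noteq> y" for x y using clique_adj[OF X that] .
  have priv: "priv X c \<noteq> {}" if c: "c \<in> X" for c
  proof (rule priv_ne[OF M c])
    obtain r where r: "r \<in> X" "r \<noteq> c" using third by metis
    show "conn (X - {c})"
      by (rule conn_hub[OF conn_singleton[of r]]) (use r e in auto)
    show "X \<noteq> {c}" using r by blast
  qed
  have PP: "\<not> E pa pb" if ab: "a \<in> X" "b \<in> X" "a \<noteq> b" and p: "pa \<in> priv X a" "pb \<in> priv X b" for a b pa pb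
  proof
    assume adj: "E pa pb"
    obtain c where c: "c \<in> X" "c \<noteq> a" "c \<noteq> b" using third by blast
    obtain pc where pc: "pc \<in> priv X c" using priv c by blast
    have "(\<forall>q\<in>priv X b. E q pa) \<or> (\<forall>q\<in>priv X a. E q pb)"
      using clique_privates_one_sided[OF no6 X ab(1,2) c(1) ab(3) c(2,3) p pc _ _ adj] by blast
    then obtain Y s Q R where "min_cds Y" "two_star Y s Q R"
      using two_star_if_clique[OF M X ab(1,2) c(1) ab(3) c(2,3) p(1)]
        two_star_if_clique[OF M X ab(2,1) c(1) ab(3)[symmetric] c(3,2) p(2)] by blast
    then show False using anticomplete_cells_if_two_star[OF no6 no2] no by blast
  qed
  have anti: "\<not> touches p (priv X d)" if "c \<in> X" "d \<in> X" "c \<noteq> d" "p \<in> priv X c" for c d p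
    using PP[OF that(1-3)] that priv_disjoint unfolding touches_def by blast
  \<comment> \<open>With \<open>pa\<close> and \<open>pb\<close> as two leaves, claw-freeness at
    \<open>x\<close> leaves only \<open>a\<close> and \<open>b\<close> as possible neighbours in
    \<open>X\<close>. Seeing only one of them, \<open>x\<close> would be a private neighbour and
    could not touch the other cell.\<close>
  have touch: "E x a \<and> E x b \<and> (\<forall>c\<in>X. c \<noteq> a \<longrightarrow> c \<noteq> b \<longrightarrow> \<not> E x c \<and> x \<noteq> c \<and> (\<forall>pc\<in>priv X c. \<not> E x pc)) \<and>
      (\<exists>pa\<in>priv X a. E x pa \<and> (\<exists>pb\<in>priv X b. E x pb))"
    if ab: "a \<in> X" "b \<in> X" "a \<noteq> b" and t: "touches x (priv X a)" "touches x (priv X b)" for x a b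
  proof -
    have "x \<notin> priv X a" "x \<notin> priv X b" using anti[OF ab] anti[OF ab(2,1) ab(3)[symmetric]] t by blast+
    then obtain pa pb where p: "pa \<in> priv X a" "pb \<in> priv X b" and x: "E x pa" "E x pb"
      using t unfolding touches_def by blast
    have n: "\<not> E pa pb" "pa \<noteq> pb" using PP[OF ab p] priv_disjoint[OF p ab(1,3)] by blast+
    have 1: "\<not> E x c" "\<not> E x pc" "x \<noteq> c" if c: "c \<in> X" "c \<noteq> a" "c \<noteq> b" "pc \<in> priv X c" for c pc
    proof -
      show "\<not> E x c"
        using claw_nonadj[of x pa pb c] x n c privD(5)[OF p(1) c(1,2)] privD(5)[OF p(2) c(1,3)]
          privD(2)[OF p(1)] privD(2)[OF p(2)] by metis
      show "\<not> E x pc"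
        using claw_nonadj[of x pa pb pc] x n PP[OF ab(1) c(1) c(2)[symmetric] p(1) c(4)]
          PP[OF ab(2) c(1) c(3)[symmetric] p(2) c(4)] priv_disjoint[OF p(1) c(4) ab(1) c(2)[symmetric]]
          priv_disjoint[OF p(2) c(4) ab(2) c(3)[symmetric]] by metis
      show "x \<noteq> c" using x privD(5)[OF p(1) c(1,2)] by blast
    qed
    have xX: "x \<notin> X"
      using x privD(5)[OF p(1), of x] privD(5)[OF p(2), of x] ab(3) by blast
    have "x \<in> V" using x adj_V by blast
    then obtain y where y: "y \<in> X" "E x y"
      using XV(3) xX unfolding dominating_def covers_def by blast
    have y_ab: "z = a \<or> z = b" if "z \<in> X" "E x z" for z using 1(1) that priv by blast
    have "E x b"
    proof (rule ccontr)
      assume "\<not> E x b"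
      then have "x \<in> priv X a"
        using y y_ab xX \<open>x \<in> V\<close> adj_sym unfolding priv_def by blast
      then show False using \<open>x \<notin> priv X a\<close> by blast
    qed
    moreover have "E x a"
    proof (rule ccontr)
      assume "\<not> E x a"
      then have "x \<in> priv X b"
        using y y_ab xX \<open>x \<in> V\<close> adj_sym unfolding priv_def by blast
      then show False using \<open>x \<notin> priv X b\<close> by blast
    qed
    ultimately show ?thesis using 1 priv p x by blast
  qed
  have small: "\<exists>S. dominating S \<and> card S < card X"
    if ab: "a \<in> X" "b \<in> X" "a \<noteq> b" and t: "touches x (priv X a)" "touches x (priv X b)" for x a b
  proof -
    \<comment> \<open>\<open>x\<close> replaces \<open>a\<close> and \<open>b\<close>. A missed
      vertex would see \<open>a\<close> or \<open>b\<close> and form a claw there with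
      \<open>x\<close> and \<open>c\<close>.\<close>
    let ?S = "insert x (X - {a, b})"
    have x: "E x a" "E x b" and nx: "\<And>c. c \<in> X \<Longrightarrow> c \<noteq> a \<Longrightarrow> c \<noteq> b \<Longrightarrow> \<not> E x c \<and> x \<noteq> c"
      using touch[OF ab t] by blast+
    obtain c where c: "c \<in> X" "c \<noteq> a" "c \<noteq> b" using third by blast
    have hub: False if a: "a \<in> X" "a \<noteq> c" "E x a" and w: "w \<noteq> x" "\<not> E w x" "\<not> E w c" "w \<noteq> c" "E w a" for a w
      using claw_nonadj[of a w x c] e[of a c] a w c nx[OF c] adj_commute[of a w] adj_commute[of a x] by metis
    have "dominating ?S"
      unfolding dominating_def
    proof (intro conjI ballI)
      show "?S \<subseteq> V" using x adj_V XV by blast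
      fix w assume w: "w \<in> V"
      show "covers ?S w"
      proof (rule ccontr)
        assume "\<not> covers ?S w"
        then have nw: "w \<noteq> x" "\<not> E w x" "\<And>c. c \<in> X \<Longrightarrow> c \<noteq> a \<Longrightarrow> c \<noteq> b \<Longrightarrow> \<not> E w c \<and> w \<noteq> c"
          unfolding covers_def by blast+
        have "w \<notin> X" using nw x adj_sym by blast
        then obtain y where "y \<in> X" "E w y" using w XV(3) unfolding dominating_def covers_def by blast
        then have "E w a \<or> E w b" using nw by blast
        then show False using hub[of a w] hub[of b w] nw(1,2) nw(3)[OF c] ab c x by blast
      qed
    qed
    moreover have "card ?S < card X"
    proof -
      have "card ?S \<le> Suc (card (X - {a, b}))" using XV by (simp add: card_insert_if)
      moreover have "card (X - {a, b}) < card (X - {a})"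
        by (rule psubset_card_mono) (use XV ab in auto)
      moreover have "card (X - {a}) < card X"
        by (rule psubset_card_mono) (use XV ab in auto)
      ultimately show ?thesis by linarith
    qed
    ultimately show ?thesis by blast
  qed
  have meet: "{a, b} \<inter> {c, d} \<noteq> {}"
    if in_X: "a \<in> X" "b \<in> X" "c \<in> X" "d \<in> X" and tx: "touches x (priv X a)" "touches x (priv X b)"
      and ty: "touches y (priv X c)" "touches y (priv X d)" and ne: "a \<noteq> b" "c \<noteq> d" for x y a b c d
  proof
    assume "{a, b} \<inter> {c, d} = {}"
    then have di: "a \<noteq> c" "a \<noteq> d" "b \<noteq> c" "b \<noteq> d" by blast+
    note tx' = touch[OF in_X(1,2) ne(1) tx] note ty' = touch[OF in_X(3,4) ne(2) ty]
    obtain pa pb where p: "pa \<in> priv X a" "E x pa" "pb \<in> priv X b" "E x pb" using tx' by blast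
    obtain pd where pd: "pd \<in> priv X d" "E y pd" using ty' by blast
    have x: "E x a" "E x b" "\<not> E x c" "\<not> E x pd"
      using tx' in_X di di[symmetric] pd(1) by simp_all
    have y: "E y c" "\<not> E y b" "\<not> E y pa" "\<not> E y pb"
      using ty' in_X di p by simp_all
    have n: "\<not> E pa pb" "pa \<noteq> pb" "\<not> E pa pd"
      using PP[OF in_X(1,2) ne(1) p(1,3)] priv_disjoint[OF p(1,3) in_X(1) ne(1)]
        PP[OF in_X(1,4) di(2) p(1) pd(1)] by blast+
    \<comment> \<open>A claw at \<open>x\<close> excludes this edge; for disjoint touched pairs
      \<open>pa x b c y pd\<close> is then an induced path.\<close>
    have xy: "\<not> E x y"
      using claw_nonadj[of x pa pb y] p n y adj_commute[of y pa] adj_commute[of y pb]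
        privD(5)[OF p(1) in_X(3)] privD(5)[OF p(3) in_X(3)] di \<open>E y c\<close> by metis
    show False
      using P6[of pa x b c y pd] p x y n xy pd e[OF in_X(2,3) di(3)]
        adj_commute[of x pa] adj_commute[of c y] adj_commute[of b y] adj_commute[of pa y]
        privD(5)[OF p(1) in_X(2)] privD(5)[OF p(1) in_X(3)] privD(5)[OF pd(1) in_X(2)]
        privD(5)[OF pd(1) in_X(3)] ne di by metis
  qed
  have pV: "priv X a \<subseteq> V" for a unfolding priv_def by blast
  have "anticomplete_cells X (priv X)"
    unfolding anticomplete_cells_def
    using XV(3) priv pV anti small meet by (intro conjI ballI allI impI; meson)
  then show False using no by blast
qed

theorem two_clique_cover_or_anticomplete_cells:
  assumes "V \<noteq> {}"
  shows "two_clique_cover \<or> (\<exists>C P. anticomplete_cells C P)"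
proof (cases two_clique_cover)
  case False
  then have no6: "\<not> C6 a b c d e f" for a b c d e f using two_clique_cover_if_C6 by blast
  obtain X where X: "min_cds X" using min_cds_exists assms by blast
  show ?thesis
    using min_cds_structure[OF X no6] anticomplete_cells_if_clique[OF no6 False X]
      anticomplete_cells_if_two_star[OF no6 False X] by blast
qed simp

end

section \<open>Translation to pair graphs\<close>

lemma pair_graph_simple_graph:
  assumes "pair_graph G"
  shows "simple_graph (pverts G) (\<lambda>u v. (u, v) \<in> parcs G)"
proof -
  interpret pair_graph G by fact
  show ?thesis
  proof
    show "finite (pverts G)" by (rule pair_finite_verts)
    show "(v, u) \<in> parcs G" if "(u, v) \<in> parcs G" for u v
      using pair_sym_arcs that unfolding symmetric_def by (auto dest: symD)
    show "(u, u) \<notin> parcs G" for u using pair_no_loops[of "(u, u)"] by auto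
    show "u \<in> pverts G" if "(u, v) \<in> parcs G" for u v using in_arcsD1 that .
  qed
qed

lemma claw_of_claw_free:
  assumes "pair_graph G"
    and free: "\<not> (\<exists>C. induced_subgraph C (with_proj G) \<and> K\<^bsub>1,3\<^esub> C)"
    and arcs: "(c, x) \<in> parcs G" "(c, y) \<in> parcs G" "(c, z) \<in> parcs G"
    and ne: "x \<noteq> y" "y \<noteq> z" "x \<noteq> z"
  shows "(x, y) \<in> parcs G \<or> (y, z) \<in> parcs G \<or> (x, z) \<in> parcs G"
proof (rule ccontr)
  assume no: "\<not> ?thesis"
  interpret simple_graph "pverts G" "\<lambda>u v. (u, v) \<in> parcs G"
    by (rule pair_graph_simple_graph) fact
  interpret G: pair_graph G by fact
  let ?U = "{c}" and ?V = "{x, y, z}"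
  define C where "C = \<lparr> pverts = ?U \<union> ?V, parcs = ?U \<times> ?V \<union> ?V \<times> ?U \<rparr>"
  have in_C: "(u, v) \<in> parcs C \<longleftrightarrow> (u, v) \<in> parcs G \<and> u \<in> pverts C \<and> v \<in> pverts C" for u v
    using arcs no adj_irrefl adj_sym unfolding C_def by auto
  have c: "c \<notin> ?V" using arcs adj_irrefl by blast
  have "K\<^bsub>1,3\<^esub> (with_proj C)"
    unfolding complete_bipartite_digraph_pair_def
    by (intro conjI exI[of _ ?U] exI[of _ ?V]) (use c ne in \<open>auto simp: C_def\<close>)
  moreover have "induced_subgraph (with_proj C) (with_proj G)"
  proof -
    have "pair_wf_digraph C"
      by unfold_locales (auto simp: C_def)
    then have "wf_digraph (with_proj C)" by (simp add: wf_digraph_wp_iff)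
    moreover have "pverts C \<subseteq> pverts G" using arcs adj_V adj_sym unfolding C_def by auto
    moreover have "parcs C = {e \<in> parcs G. fst e \<in> pverts C \<and> snd e \<in> pverts C}"
      using in_C by auto
    ultimately show ?thesis
      unfolding induced_subgraph_def subgraph_def compatible_def using G.wf_digraph_axioms
      by auto
  qed
  ultimately show False using free by blast
qed

lemma P6_of_P6_free:
  assumes "pair_graph G"
    and free: "\<not> (\<exists>C. induced_subgraph C (with_proj G) \<and> digraph_iso (with_proj (path_graph 6)) C)"
    and arcs: "(a, b) \<in> parcs G" "(b, c) \<in> parcs G" "(c, d) \<in> parcs G" "(d, e) \<in> parcs G"
      "(e, f) \<in> parcs G"
    and no: "(a, c) \<notin> parcs G" "(a, d) \<notin> parcs G" "(a, e) \<notin> parcs G" "(a, f) \<notin> parcs G"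
      "(b, d) \<notin> parcs G" "(b, e) \<notin> parcs G" "(b, f) \<notin> parcs G"
      "(c, e) \<notin> parcs G" "(c, f) \<notin> parcs G" "(d, f) \<notin> parcs G"
  shows False
proof -
  interpret simple_graph "pverts G" "\<lambda>u v. (u, v) \<in> parcs G"
    by (rule pair_graph_simple_graph) fact
  interpret G: pair_graph G by fact
  let ?xs = "[a, b, c, d, e, f]"
  have di: "distinct ?xs" using arcs no adj_irrefl adj_sym by auto
  have sym: "(b, a) \<in> parcs G" "(c, b) \<in> parcs G" "(d, c) \<in> parcs G" "(e, d) \<in> parcs G" "(f, e) \<in> parcs G"
    "(c, a) \<notin> parcs G" "(d, a) \<notin> parcs G" "(e, a) \<notin> parcs G" "(f, a) \<notin> parcs G"
    "(d, b) \<notin> parcs G" "(e, b) \<notin> parcs G" "(f, b) \<notin> parcs G"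
    "(e, c) \<notin> parcs G" "(f, c) \<notin> parcs G" "(f, d) \<notin> parcs G"
    using arcs no adj_sym by blast+
  \<comment> \<open>\<open>h\<close> is the isomorphism from the standard path onto the induced
    one.\<close>
  define h where "h i = ?xs ! i" for i
  have inj: "inj_on h {..<6}"
    unfolding h_def by (rule inj_on_nth[OF di]) simp
  have adj: "(h i, h j) \<in> parcs G \<longleftrightarrow> j = Suc i \<or> i = Suc j" if "i < 6" "j < 6" for i j
  proof -
    have "i \<in> {0, 1, 2, 3, 4, 5}" "j \<in> {0, 1, 2, 3, 4, 5}" using that by auto
    then show ?thesis
      by (elim insertE emptyE) (simp_all add: h_def arcs no sym adj_irrefl)
  qed
  have hV: "h i \<in> pverts G" if "i < 6" for i
  proof -
    have "i \<in> {0, 1, 2, 3, 4, 5}" using that by auto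
    then show ?thesis using arcs adj_V adj_V'[OF arcs(5)] unfolding h_def by auto
  qed
  define C where "C = \<lparr> pverts = h ` {..<6}, parcs = map_prod h h ` parcs (path_graph 6) \<rparr>"
  have "induced_subgraph (with_proj C) (with_proj G)"
  proof -
    have "pair_wf_digraph C"
      by unfold_locales (auto simp: C_def path_graph_def)
    then have "wf_digraph (with_proj C)" by (simp add: wf_digraph_wp_iff)
    moreover have "pverts C \<subseteq> pverts G" using hV unfolding C_def by auto
    moreover have "parcs C = {e \<in> parcs G. fst e \<in> pverts C \<and> snd e \<in> pverts C}"
    proof (intro set_eqI iffI)
      fix x assume "x \<in> parcs C"
      then show "x \<in> {e \<in> parcs G. fst e \<in> pverts C \<and> snd e \<in> pverts C}"
        using adj unfolding C_def path_graph_def by auto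
    next
      fix x assume "x \<in> {e \<in> parcs G. fst e \<in> pverts C \<and> snd e \<in> pverts C}"
      then obtain i j where ij: "x = (h i, h j)" "i < 6" "j < 6" "x \<in> parcs G"
        unfolding C_def by (cases x) auto
      then have "(i, j) \<in> parcs (path_graph 6)" using adj unfolding path_graph_def by auto
      then show "x \<in> parcs C" using ij unfolding C_def by force
    qed
    ultimately show ?thesis
      unfolding induced_subgraph_def subgraph_def compatible_def using G.wf_digraph_axioms
      by auto
  qed
  moreover have "digraph_iso (with_proj (path_graph 6)) (with_proj C)"
    unfolding digraph_iso_def
  proof (intro exI conjI)
    let ?f = "\<lparr> iso_verts = h, iso_arcs = map_prod h h, iso_head = snd, iso_tail = fst \<rparr>"
    interpret P: pair_graph "path_graph 6" by (rule pair_graph_path_graph)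
    have sub: "parcs (path_graph 6) \<subseteq> {..<6} \<times> {..<6}" by (auto simp: path_graph_def)
    have "inj_on (map_prod h h) (parcs (path_graph 6))"
      by (rule inj_on_subset[OF map_prod_inj_on[OF inj inj] sub])
    then show "pre_digraph.digraph_isomorphism (with_proj (path_graph 6)) ?f"
      unfolding pre_digraph.digraph_isomorphism_def
      using inj P.wf_digraph_axioms by (auto simp: path_graph_def)
    show "with_proj C = app_iso ?f (with_proj (path_graph 6))"
      by (simp add: app_iso_def with_proj_def C_def path_graph_def)
  qed
  ultimately show False using free by blast
qed

lemma conn_of_connected:
  assumes "pair_graph G" "connected (with_proj G)"
  shows "simple_graph.conn (\<lambda>u v. (u, v) \<in> parcs G) (pverts G)" "pverts G \<noteq> {}"
proof -
  interpret simple_graph "pverts G" "\<lambda>u v. (u, v) \<in> parcs G"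
    by (rule pair_graph_simple_graph) fact
  interpret G: pair_graph G by fact
  have sc: "strongly_connected (with_proj G)"
    by (rule G.symmetric_connected_imp_strongly_connected[OF G.pair_sym_arcs assms(2)])
  then show "pverts G \<noteq> {}" unfolding strongly_connected_def by simp
  show "conn (pverts G)"
    unfolding conn_def
  proof (intro allI impI, rule ccontr)
    fix S assume S: "S \<subseteq> pverts G" "S \<noteq> {}" "S \<noteq> pverts G"
      and no: "\<not> (\<exists>u\<in>S. \<exists>w\<in>pverts G - S. (u, w) \<in> parcs G)"
    obtain u w where uw: "u \<in> S" "w \<in> pverts G" "w \<notin> S" using S by blast
    have "u \<rightarrow>\<^sup>*\<^bsub>with_proj G\<^esub> w"
      using sc uw S unfolding strongly_connected_def by auto
    then have "(u, w) \<in> (parcs G)\<^sup>*"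
      using reachable_rtranclI[of "with_proj G" u w] by simp
    \<comment> \<open>A set that no arc leaves is closed under reachability.\<close>
    then have "w \<in> S"
      by (induction rule: rtrancl_induct) (use uw no adj_V' in blast)+
    then show False using uw by blast
  qed
qed

theorem theorem3p3:
  fixes G :: "'a pair_pre_digraph" and H :: "'b pair_pre_digraph"
  assumes "pair_graph G" and "connected (with_proj G)"
    and claw_free: "\<not> (\<exists>C. induced_subgraph C (with_proj G) \<and> K\<^bsub>1,3\<^esub> C)"
    and P6_free: "\<not> (\<exists>C. induced_subgraph C (with_proj G) \<and>
                         digraph_iso (with_proj (path_graph 6)) C)"
    and "pair_graph H" and "connected (with_proj H)"
  shows "domination_number (cartesian_product G H) \<ge> domination_number G * domination_number H"
proof -
  interpret G: simple_graph "pverts G" "\<lambda>u v. (u, v) \<in> parcs G"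
    by (rule pair_graph_simple_graph) fact
  interpret H: simple_graph "pverts H" "\<lambda>u v. (u, v) \<in> parcs H"
    by (rule pair_graph_simple_graph) fact
  interpret G: claw_P6_free_graph "pverts G" "\<lambda>u v. (u, v) \<in> parcs G"
    using claw_of_claw_free[OF assms(1) claw_free] P6_of_P6_free[OF assms(1) P6_free]
      conn_of_connected[OF assms(1,2)]
    by unfold_locales blast+
  obtain S where S: "dominating_set (cartesian_product G H) S"
      "card S = domination_number (cartesian_product G H)"
    by (rule domination_number_attained)
  have S_sub: "S \<subseteq> pverts G \<times> pverts H"
    using S(1) unfolding dominating_set_def cartesian_product_def by simp
  then have "finite S" by (rule finite_subset) (simp add: G.finite_V H.finite_V)
  define D where "D h = {x. (x, h) \<in> S}" for h
  have dom_eq: "dominating_set G T \<longleftrightarrow> G.dominating T" for T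
    unfolding dominating_set_def G.dominating_def G.covers_def by blast
  interpret claw_free_product "pverts G" "\<lambda>u v. (u, v) \<in> parcs G" "pverts H"
    "\<lambda>u v. (u, v) \<in> parcs H" D "domination_number G" "domination_number H"
  proof
    fix h x assume h: "h \<in> pverts H" and x: "x \<in> pverts G"
    then have "(x, h) \<in> S \<or> (\<exists>u\<in>S. ((x, h), u) \<in> parcs (cartesian_product G H))"
      using S(1) unfolding dominating_set_def cartesian_product_def by auto
    then show "G.covers (D h) x \<or> (\<exists>k\<in>pverts H. (h, k) \<in> parcs H \<and> x \<in> D k)"
      unfolding G.covers_def D_def cartesian_product_def by auto
  next
    fix T assume "T \<subseteq> pverts H" "\<And>h. h \<in> pverts H \<Longrightarrow> h \<in> T \<or> (\<exists>k\<in>T. (h, k) \<in> parcs H)"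
    then show "domination_number H \<le> card T"
      by (intro domination_number_le) (auto simp: dominating_set_def)
  next
    fix T assume "G.dominating T"
    then show "domination_number G \<le> card T" using dom_eq domination_number_le by blast
  qed (use S_sub H.finite_V H.adj_sym H.adj_irrefl G.claw in \<open>auto simp: D_def\<close>)
  have "domination_number G * domination_number H \<le> (\<Sum>h\<in>pverts H. card (D h))"
    using G.two_clique_cover_or_anticomplete_cells[OF conn_of_connected(2)[OF assms(1,2)]]
      bound_if_two_clique_cover bound_if_anticomplete_cells by blast
  \<comment> \<open>The fibres partition \<open>S\<close>, up to swapping coordinates.\<close>
  also have "\<dots> = card (SIGMA h:pverts H. D h)"
    using H.finite_V finite_D by simp
  also have "\<dots> = card S"
  proof -
    have "S = prod.swap ` (SIGMA h:pverts H. D h)"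
      using S_sub unfolding D_def by (auto simp: image_iff)
    then show ?thesis by (metis card_image inj_swap inj_on_subset subset_UNIV)
  qed
  finally show ?thesis using S(2) by simp
qed

end
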